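(* Assume (D1)–(D4) and (F1)–(F3) (listed in the context), and consider the local skew-product semiflow $\tau(t,\omega,x)=(\omega\cdot t,u(t,\omega,x))$ on $\Omega\times BU$ induced by the family of neutral functional differential equations $$\frac{d}{dt}Dz_t=F(\omega\cdot t,z_t),\quad t\ge0,\ \omega\in\Omega.$$ Assume that $(\omega,x)\in\Omega\times BU$ admits a backward orbit extension and that there is a $k_1>0$ such that $u(t,\omega,x)\in B_{k_1}$ for each $t\in\mathbb{R}$. Then $z(t)=z(t,\omega,x)$, the solution of the equation for $\omega$ with initial value $x$, belongs to $C^1(\mathbb{R},\mathbb{R}^m)$.
   Context: $X=C((-\infty,0],\mathbb{R}^m)$ with the compact-open topology, metrized by $\mathsf{d}(x,y)=\sum_{n\ge1}2^{-n}\frac{\|x-y\|_n}{1+\|x-y\|_n}$, $\|x\|_n=\sup_{s\in[-n,0]}\|x(s)\|$, where $\|\cdot\|$ is the maximum norm on $\mathbb{R}^m$. $BU\subset X$ is the Banach space of bounded, uniformly continuous functions with norm $\|x\|_\infty=\sup_{s\le0}\|x(s)\|$, and $B_k=\{x\in BU:\|x\|_\infty\le k\}$. For a continuous function $x$ on $(-\infty,a]$ (or $\mathbb{R}$) and $t$ in its domain, $x_t(s)=x(t+s)$ for $s\le0$. Operator $D\colon BU\to\mathbb{R}^m$: (D1) $D$ is linear and norm-continuous. (D2) For each $k>0$, $D|_{B_k}$ is continuous for the compact-open topology. (D3) $D$ is atomic at $0$; without loss of generality $D$ has the form $Dx=x(0)-\int_{-\infty}^0[d\nu(s)]x(s)$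 with $\nu=[\nu_{ij}]$ an $m\times m$ matrix of real regular Borel measures of finite total variation with $|\nu_{ij}|(\{0\})=0$. (D4) $D$ is stable: there is a continuous $c\colon[0,\infty)\to[0,\infty)$ with $c(t)\to0$ as $t\to\infty$ such that for each $\varphi\in BU$ with $D\varphi=0$ the solution of $Dx_t=0$ ($t\ge0$), $x_0=\varphi$, satisfies $\|x(t)\|\le c(t)\|\varphi\|_\infty$ for all $t\ge0$. $(\Omega,\sigma,\mathbb{R})$ is a minimal continuous flow on a compact metric space, $\omega\cdot t=\sigma(t,\omega)$. The function $F\colon\Omega\times BU\to\mathbb{R}^m$ satisfies: (F1) $F$ is continuous on $\Omega\times BU$ and locally Lipschitz in $x$ for $\|\cdot\|_\infty$. (F2) For each $k>0$, $F(\Omega\times B_k)$ is bounded. (F3) For each $k>0$, $F\colon\Omega\times B_k\to\mathbb{R}^m$ is continuous when $B_k$ carries the compact-open topology. For $(\omega,x)\in\Omega\times BU$, $z(t,\omega,x)$ is the unique (locally defined) solution with $z(s,\omega,x)=x(s)$ for $s\le0$, and $u(t,\omega,x)\in BU$ is $u(t,\omega,x)(s)=z(t+s,\omega,x)$, $s\le0$. $(\omega,x)$ admits a backward orbit extension if there is a continuous map $\psi\colon(-\infty,0]\to\Omega\times BU$ with $\psi(0)=(\omega,x)$ and $\tau(t,\psi(s))=\psi(s+t)$ whenever $s\le0$, $0\le t\le -s$. In that case, for $t\le0$, $u(t,\omega,x)$ denotes the $BU$-component of $\psi(t)$, i.e. $u(t,\omega,x)=x_t$, and $z(t,\omega,x)=x(t)$.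 *)

theory Defs
  imports "HOL-Analysis.Analysis"
begin

section \<open>The phase space\<close>

text \<open>
  A function on the half-line \<open>{..0}\<close> is represented by its extension to the whole line that is
  constant on \<open>{0..}\<close>; every function on \<open>{..0}\<close> has exactly one such representative. Values on
  \<open>\<real>\<^sup>m\<close> are measured in the maximum norm \<^const>\<open>infnorm\<close>.
\<close>

typedef 'm bu = "{x :: real \<Rightarrow> real ^ 'm :: finite.
    uniformly_continuous_on {..0} x \<and> bounded (x ` {..0}) \<and> (\<forall>s>0. x s = x 0)}"
  morphisms apply_bu Bu
  by (rule exI[of _ "\<lambda>_. 0"]) (auto intro: uniformly_continuous_on_const simp: image_constant_conv)

setup_lifting type_definition_bu

lemma bu_eqI: "(\<And>s. s \<le> 0 \<Longrightarrow> apply_bu x s = apply_bu y s) \<Longrightarrow> x = y"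
  by transfer (metis linorder_not_le order_refl ext)

lemma uniformly_continuous_on_apply_bu: "uniformly_continuous_on {..0} (apply_bu x)"
  by transfer auto

lemma bounded_apply_bu: "bounded (apply_bu x ` {..0})"
  by transfer auto

lemma bdd_above_infnorm_bu: "A \<subseteq> {..0} \<Longrightarrow> bdd_above ((\<lambda>s. infnorm (apply_bu x s)) ` A)"
proof -
  assume A: "A \<subseteq> {..0}"
  obtain b where "\<And>s. s \<le> 0 \<Longrightarrow> norm (apply_bu x s) \<le> b"
    using bounded_apply_bu[of x] by (auto simp: bounded_iff)
  then have "infnorm (apply_bu x s) \<le> b" if "s \<le> 0" for s
    using infnorm_le_norm order_trans that by blast
  then show ?thesis using A by (auto intro!: bdd_aboveI[of _ b])
qed

instantiation bu :: (finite) real_vector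
begin

lift_definition zero_bu :: "'a bu" is "\<lambda>_. 0"
  by (auto intro: uniformly_continuous_on_const simp: image_constant_conv)

lift_definition plus_bu :: "'a bu \<Rightarrow> 'a bu \<Rightarrow> 'a bu" is "\<lambda>x y s. x s + y s"
  by (auto intro: uniformly_continuous_on_add bounded_plus_comp)

lift_definition minus_bu :: "'a bu \<Rightarrow> 'a bu \<Rightarrow> 'a bu" is "\<lambda>x y s. x s - y s"
  by (auto intro: uniformly_continuous_on_diff bounded_minus_comp)

lift_definition uminus_bu :: "'a bu \<Rightarrow> 'a bu" is "\<lambda>x s. - x s"
  by (auto intro: uniformly_continuous_on_minus)

lift_definition scaleR_bu :: "real \<Rightarrow> 'a bu \<Rightarrow> 'a bu" is "\<lambda>c x s. c *\<^sub>R x s"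
  by (auto intro: uniformly_continuous_on_cmul bounded_scaleR_comp)

instance
  by standard (auto intro!: bu_eqI simp: plus_bu.rep_eq minus_bu.rep_eq uminus_bu.rep_eq
    scaleR_bu.rep_eq zero_bu.rep_eq algebra_simps)

end

instantiation bu :: (finite) real_normed_vector
begin

definition norm_bu :: "'a bu \<Rightarrow> real"
  where "norm_bu x = (SUP s\<in>{..0}. infnorm (apply_bu x s))"

definition sgn_bu :: "'a bu \<Rightarrow> 'a bu" where "sgn_bu x = x /\<^sub>R norm x"

definition dist_bu :: "'a bu \<Rightarrow> 'a bu \<Rightarrow> real" where "dist_bu x y = norm (x - y)"

definition uniformity_bu :: "('a bu \<times> 'a bu) filter"
  where "uniformity_bu = (INF e\<in>{0 <..}. principal {(x, y). dist x y < e})"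

definition open_bu :: "'a bu set \<Rightarrow> bool"
  where "open_bu S = (\<forall>x\<in>S. \<forall>\<^sub>F (x', y) in uniformity. x' = x \<longrightarrow> y \<in> S)"

lemma infnorm_le_norm_bu: "s \<le> 0 \<Longrightarrow> infnorm (apply_bu x s) \<le> norm x"
  unfolding norm_bu_def by (rule cSUP_upper) (auto intro: bdd_above_infnorm_bu)

lemma norm_bu_le: "(\<And>s. s \<le> 0 \<Longrightarrow> infnorm (apply_bu x s) \<le> b) \<Longrightarrow> norm x \<le> b"
  unfolding norm_bu_def by (rule cSUP_least) auto

instance
proof
  fix x y z :: "'a bu" and a b :: real
  show "norm x = 0 \<longleftrightarrow> x = 0"
  proof
    assume 0: "norm x = 0"
    have "apply_bu x s = 0" if "s \<le> 0" for s
      using infnorm_le_norm_bu[OF that, of x] 0 by (metis infnorm_eq_0 infnorm_pos_le order_antisym)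
    then show "x = 0"
      by (intro bu_eqI) (simp add: zero_bu.rep_eq)
  qed (simp add: norm_bu_def zero_bu.rep_eq infnorm_0)
  show "norm (x + y) \<le> norm x + norm y"
  proof (rule norm_bu_le)
    fix s :: real assume "s \<le> 0"
    then show "infnorm (apply_bu (x + y) s) \<le> norm x + norm y"
      using infnorm_triangle[of "apply_bu x s" "apply_bu y s"]
        infnorm_le_norm_bu[of s x] infnorm_le_norm_bu[of s y] by (simp add: plus_bu.rep_eq)
  qed
  have le: "norm (a *\<^sub>R x) \<le> \<bar>a\<bar> * norm x" for a :: real and x :: "'a bu"
    by (rule norm_bu_le)
      (simp add: scaleR_bu.rep_eq infnorm_mul mult_left_mono infnorm_le_norm_bu)
  show "norm (a *\<^sub>R x) = \<bar>a\<bar> * norm x"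
  proof (cases "a = 0")
    case True
    then show ?thesis
      by (simp add: norm_bu_def zero_bu.rep_eq infnorm_0)
  next
    case False
    have "inverse a *\<^sub>R a *\<^sub>R x = x"
      using False by (intro bu_eqI) (simp add: scaleR_bu.rep_eq)
    then have "norm x \<le> \<bar>inverse a\<bar> * norm (a *\<^sub>R x)"
      using le[of "inverse a" "a *\<^sub>R x"] by simp
    then have "\<bar>a\<bar> * norm x \<le> norm (a *\<^sub>R x)"
      using False by (simp add: abs_inverse field_simps)
    with le[of a x] show ?thesis by simp
  qed
qed (simp_all add: sgn_bu_def dist_bu_def uniformity_bu_def open_bu_def)

end

text \<open>
  The compact-open topology, given on all of \<open>C({..0}, \<real>\<^sup>m)\<close> by the metric \<open>\<d>\<close> below, restricted
  to the bounded uniformly continuous functions.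
\<close>

definition seminorm_bu :: "nat \<Rightarrow> 'm::finite bu \<Rightarrow> real"
  where "seminorm_bu n x = (SUP s\<in>{- real n..0}. infnorm (apply_bu x s))"

definition co_dist :: "'m::finite bu \<Rightarrow> 'm bu \<Rightarrow> real"
  where "co_dist x y = (\<Sum>k. let n = Suc k in
    (1/2) ^ n * (seminorm_bu n (x - y) / (1 + seminorm_bu n (x - y))))"

definition co_topology :: "'m::finite bu topology"
  where "co_topology = Metric_space.mtopology UNIV co_dist"

lemma infnorm_le_seminorm_bu: "- real n \<le> s \<Longrightarrow> s \<le> 0 \<Longrightarrow> infnorm (apply_bu x s) \<le> seminorm_bu n x"
  unfolding seminorm_bu_def by (rule cSUP_upper) (auto intro: bdd_above_infnorm_bu)

lemma seminorm_bu_le: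
  "(\<And>s. - real n \<le> s \<Longrightarrow> s \<le> 0 \<Longrightarrow> infnorm (apply_bu x s) \<le> b) \<Longrightarrow> seminorm_bu n x \<le> b"
  unfolding seminorm_bu_def by (rule cSUP_least) auto

lemma seminorm_bu_nonneg: "0 \<le> seminorm_bu n x"
  using infnorm_le_seminorm_bu[of n 0 x] infnorm_pos_le order_trans by auto

lemma seminorm_bu_triangle: "seminorm_bu n (x + y) \<le> seminorm_bu n x + seminorm_bu n y"
proof (rule seminorm_bu_le)
  fix s :: real assume "- real n \<le> s" "s \<le> 0"
  then show "infnorm (apply_bu (x + y) s) \<le> seminorm_bu n x + seminorm_bu n y"
    using infnorm_triangle[of "apply_bu x s" "apply_bu y s"]
      infnorm_le_seminorm_bu[of n s x] infnorm_le_seminorm_bu[of n s y]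
    by (simp add: plus_bu.rep_eq)
qed

lemma seminorm_bu_minus_commute: "seminorm_bu n (x - y) = seminorm_bu n (y - x)"
  by (simp add: seminorm_bu_def minus_bu.rep_eq infnorm_sub)

lemma summable_co_dist:
  "summable (\<lambda>k. (1/2) ^ Suc k * (seminorm_bu (Suc k) x / (1 + seminorm_bu (Suc k) x)))"
proof (rule summable_comparison_test'[of "\<lambda>k. (1/2) ^ Suc k :: real"])
  show "summable (\<lambda>k. (1/2) ^ Suc k :: real)"
    by (simp add: summable_mult summable_geometric)
  fix k :: nat
  have "0 \<le> seminorm_bu (Suc k) x / (1 + seminorm_bu (Suc k) x)"
    "seminorm_bu (Suc k) x / (1 + seminorm_bu (Suc k) x) \<le> 1"
    using seminorm_bu_nonneg[of "Suc k" x] by (auto simp: divide_simps)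
  then have "norm (seminorm_bu (Suc k) x / (1 + seminorm_bu (Suc k) x)) \<le> 1"
    by (simp only: real_norm_def abs_of_nonneg)
  then show "norm ((1/2) ^ Suc k * (seminorm_bu (Suc k) x / (1 + seminorm_bu (Suc k) x))) \<le> (1/2) ^ Suc k"
    unfolding norm_mult by (intro mult_left_le[THEN order_trans]) (auto simp: norm_power)
qed

lemma Metric_space_co_dist: "Metric_space UNIV (co_dist :: 'm::finite bu \<Rightarrow> _)"
proof
  fix x y z :: "'m bu"
  let ?f = "\<lambda>x k. (1/2) ^ Suc k * (seminorm_bu (Suc k) x / (1 + seminorm_bu (Suc k) x))"
  have d: "co_dist x y = suminf (?f (x - y))" for x y :: "'m bu"
    by (simp add: co_dist_def Let_def)
  have nn: "0 \<le> ?f x k" for x :: "'m bu" and k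
    using seminorm_bu_nonneg[of "Suc k" x] by simp
  show "0 \<le> co_dist x y"
    unfolding d by (intro suminf_nonneg summable_co_dist nn)
  show "co_dist x y = co_dist y x"
    unfolding d by (simp only: seminorm_bu_minus_commute)
  show "co_dist x y = 0 \<longleftrightarrow> x = y"
  proof
    assume "co_dist x y = 0"
    then have z: "?f (x - y) k = 0" for k
      unfolding d using suminf_eq_zero_iff[OF summable_co_dist[of "x - y"] nn] by blast
    have "apply_bu x s = apply_bu y s" if "s \<le> 0" for s
    proof -
      obtain n where n: "- s \<le> real n" using real_arch_simple by blast
      have "seminorm_bu (Suc n) (x - y) = 0"
        using z[of n] seminorm_bu_nonneg[of "Suc n" "x - y"] by auto
      then have "infnorm (apply_bu (x - y) s) = 0"
        using infnorm_le_seminorm_bu[of "Suc n" s "x - y"] n that infnorm_pos_le[of "apply_bu (x - y) s"]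
        by auto
      then show ?thesis by (simp add: infnorm_eq_0 minus_bu.rep_eq)
    qed
    then show "x = y" by (rule bu_eqI)
  next
    assume "x = y"
    then show "co_dist x y = 0"
      by (simp add: d seminorm_bu_def zero_bu.rep_eq infnorm_0)
  qed
  show "co_dist x z \<le> co_dist x y + co_dist y z"
  proof -
    have "?f (x - z) k \<le> ?f (x - y) k + ?f (y - z) k" for k
    proof -
      let ?p = "seminorm_bu (Suc k)"
      have tr: "?p (x - z) \<le> ?p (x - y) + ?p (y - z)"
        using seminorm_bu_triangle[of "Suc k" "x - y" "y - z"] by simp
      have "a / (1 + a) \<le> b / (1 + b) + c / (1 + c)"
        if "0 \<le> a" "0 \<le> b" "0 \<le> c" "a \<le> b + c" for a b c :: real
      proof -
        have "a / (1 + a) \<le> (b + c) / (1 + (b + c))"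
          using that by (simp add: divide_simps) (simp add: algebra_simps)
        also have "\<dots> = b / (1 + (b + c)) + c / (1 + (b + c))"
          by (simp add: add_divide_distrib)
        also have "\<dots> \<le> b / (1 + b) + c / (1 + c)"
          using that by (intro add_mono divide_left_mono) auto
        finally show ?thesis .
      qed
      from mult_left_mono[OF this[OF seminorm_bu_nonneg seminorm_bu_nonneg seminorm_bu_nonneg tr],
          of "(1/2) ^ Suc k"]
      show ?thesis by (simp add: distrib_left)
    qed
    then have "suminf (?f (x - z)) \<le> (\<Sum>k. ?f (x - y) k + ?f (y - z) k)"
      by (rule suminf_le) (intro summable_co_dist summable_add)+
    also have "\<dots> = suminf (?f (x - y)) + suminf (?f (y - z))"
      by (rule suminf_add[symmetric]) (rule summable_co_dist)+
    finally show ?thesis unfolding d .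
  qed
qed

lemma topspace_co_topology: "topspace co_topology = UNIV"
  unfolding co_topology_def by (rule Metric_space.topspace_mtopology[OF Metric_space_co_dist])

abbreviation bu_ball :: "real \<Rightarrow> 'm::finite bu set"  (\<open>B\<^bsub>_\<^esub>\<close>)
  where "B\<^bsub>k\<^esub> \<equiv> {x. norm x \<le> k}"

text \<open>The history segment \<open>s \<mapsto> z (t + s)\<close>, \<open>s \<le> 0\<close>, of a function defined (at least) on \<open>{..t}\<close>.\<close>

definition history :: "(real \<Rightarrow> real ^ 'm::finite) \<Rightarrow> real \<Rightarrow> 'm bu"
  where "history z t = Bu (\<lambda>s. z (t + min s 0))"

lemma apply_history:
  assumes z: "continuous_on {..t} z" and \<phi>: "\<And>s. s \<le> 0 \<Longrightarrow> z s = apply_bu \<phi> s"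
  shows "apply_bu (history z t) s = z (t + min s 0)"
proof -
  have uc0: "uniformly_continuous_on {..0} z"
    using uniformly_continuous_on_apply_bu[of \<phi>] \<phi> unfolding uniformly_continuous_on_def by simp
  have uc1: "uniformly_continuous_on {-1..t} z"
    by (rule compact_uniformly_continuous) (auto intro: continuous_on_subset[OF z])
  have uc: "uniformly_continuous_on {..t} z"
    unfolding uniformly_continuous_on_def
  proof (intro allI impI)
    fix e :: real assume "0 < e"
    obtain d0 where d0: "d0 > 0"
      "\<And>a b. a \<le> 0 \<Longrightarrow> b \<le> 0 \<Longrightarrow> dist b a < d0 \<Longrightarrow> dist (z b) (z a) < e"
      using uc0 \<open>0 < e\<close> unfolding uniformly_continuous_on_def by (metis atMost_iff)
    obtain d1 where d1: "d1 > 0"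
      "\<And>a b. a \<in> {-1..t} \<Longrightarrow> b \<in> {-1..t} \<Longrightarrow> dist b a < d1 \<Longrightarrow> dist (z b) (z a) < e"
      using uc1 \<open>0 < e\<close> unfolding uniformly_continuous_on_def by metis
    show "\<exists>d>0. \<forall>x\<in>{..t}. \<forall>x'\<in>{..t}. dist x' x < d \<longrightarrow> dist (z x') (z x) < e"
    proof (intro exI[of _ "min 1 (min d0 d1)"] conjI ballI impI)
      fix a b assume ab: "a \<in> {..t}" "b \<in> {..t}" "dist b a < min 1 (min d0 d1)"
      show "dist (z b) (z a) < e"
      proof (cases "a \<le> 0 \<and> b \<le> 0")
        case False
        then have "a \<in> {-1..t}" "b \<in> {-1..t}" using ab by (auto simp: dist_real_def)
        then show ?thesis using d1(2) ab by auto
      qed (use d0(2) ab in auto)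
    qed (use d0(1) d1(1) in auto)
  qed
  have bd: "bounded (z ` {..t})"
  proof (rule bounded_subset)
    have "z ` {..0} = apply_bu \<phi> ` {..0}" using \<phi> by (intro image_cong) auto
    moreover have "bounded (z ` {-1..t})"
      by (intro compact_imp_bounded compact_continuous_image continuous_on_subset[OF z]) auto
    ultimately show "bounded (z ` {..0} \<union> z ` {-1..t})"
      using bounded_apply_bu[of \<phi>] by simp
    show "z ` {..t} \<subseteq> z ` {..0} \<union> z ` {-1..t}"
      unfolding image_Un[symmetric] by (rule image_mono) auto
  qed
  let ?h = "\<lambda>s. z (t + min s 0)"
  have "uniformly_continuous_on {..0} ?h"
    unfolding uniformly_continuous_on_def
  proof (intro allI impI)
    fix e :: real assume "0 < e"
    then obtain d where "d > 0"
      "\<And>a b. a \<le> t \<Longrightarrow> b \<le> t \<Longrightarrow> dist b a < d \<Longrightarrow> dist (z b) (z a) < e"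
      using uc unfolding uniformly_continuous_on_def by (metis atMost_iff)
    then show "\<exists>d>0. \<forall>x\<in>{..0}. \<forall>x'\<in>{..0}. dist x' x < d \<longrightarrow> dist (?h x') (?h x) < e"
      by (intro exI[of _ d]) (auto simp: dist_real_def)
  qed
  moreover have "bounded (?h ` {..0})"
    by (rule bounded_subset[OF bd]) auto
  ultimately show ?thesis
    unfolding history_def by (subst Bu_inverse) auto
qed

section \<open>Real Borel measures on the half-line\<close>

abbreviation half_borel :: "real measure"
  where "half_borel \<equiv> restrict_space borel {..0}"

definition total_variation :: "(real set \<Rightarrow> real) \<Rightarrow> real set \<Rightarrow> ennreal"
  where "total_variation \<nu> A =
    (SUP P\<in>{P. finite P \<and> disjoint P \<and> P \<subseteq> sets half_borel \<and> \<Union>P = A}. \<Sum>E\<in>P. ennreal \<bar>\<nu> E\<bar>)"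

definition real_measure :: "(real set \<Rightarrow> real) \<Rightarrow> bool"
  where "real_measure \<nu> \<longleftrightarrow>
    (\<forall>A :: nat \<Rightarrow> real set. range A \<subseteq> sets half_borel \<longrightarrow> disjoint_family A \<longrightarrow>
      (\<lambda>n. \<nu> (A n)) sums \<nu> (\<Union>n. A n))"

definition regular_measure :: "(real set \<Rightarrow> real) \<Rightarrow> bool"
  where "regular_measure \<nu> \<longleftrightarrow>
    (\<forall>A\<in>sets half_borel.
      total_variation \<nu> A = (INF U\<in>{U. open U \<and> A \<subseteq> U}. total_variation \<nu> (U \<inter> {..0})) \<and>
      total_variation \<nu> A = (SUP K\<in>{K. compact K \<and> K \<subseteq> A}. total_variation \<nu> K))"

text \<open>
  The positive part \<open>\<nu>\<^sup>+ = (\<bar>\<nu>\<bar> + \<nu>) / 2\<close> of the Jordan decomposition; the negative part of \<open>\<nu>\<close> is the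
  positive part of \<open>- \<nu>\<close>.
\<close>

definition positive_part :: "(real set \<Rightarrow> real) \<Rightarrow> real measure"
  where "positive_part \<nu> = measure_of {..0} (sets half_borel)
    (\<lambda>A. ennreal ((enn2real (total_variation \<nu> A) + \<nu> A) / 2))"

definition real_measure_integral :: "(real set \<Rightarrow> real) \<Rightarrow> (real \<Rightarrow> real) \<Rightarrow> real"
  where "real_measure_integral \<nu> f =
    (LINT s|positive_part \<nu>. f s) - (LINT s|positive_part (\<lambda>A. - \<nu> A). f s)"

lemma real_measure_empty: "real_measure \<nu> \<Longrightarrow> \<nu> {} = 0"
proof -
  assume "real_measure \<nu>"
  then have "(\<lambda>n::nat. \<nu> {}) sums \<nu> {}"
    unfolding real_measure_def by (auto dest!: spec[of _ "\<lambda>_. {}"] simp: disjoint_family_on_def)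
  then have "(\<lambda>n::nat. \<nu> {}) \<longlonglongrightarrow> 0"
    using sums_summable summable_LIMSEQ_zero by blast
  then show ?thesis by (simp add: LIMSEQ_const_iff)
qed

lemma total_variation_upper:
  "finite P \<Longrightarrow> disjoint P \<Longrightarrow> P \<subseteq> sets half_borel \<Longrightarrow> (\<Sum>E\<in>P. ennreal \<bar>\<nu> E\<bar>) \<le> total_variation \<nu> (\<Union>P)"
  unfolding total_variation_def by (rule SUP_upper) auto

lemma total_variation_ge: "A \<in> sets half_borel \<Longrightarrow> ennreal \<bar>\<nu> A\<bar> \<le> total_variation \<nu> A"
  using total_variation_upper[of "{A}" \<nu>] by (auto simp: disjoint_def)

lemma total_variation_empty: "real_measure \<nu> \<Longrightarrow> total_variation \<nu> {} = 0"
proof -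
  assume "real_measure \<nu>"
  then have "(\<Sum>E\<in>P. ennreal \<bar>\<nu> E\<bar>) = 0" if "\<Union>P = {}" for P
    using that real_measure_empty[of \<nu>] by (intro sum.neutral) auto
  then show ?thesis unfolding total_variation_def by (auto intro!: antisym SUP_least)
qed

lemma total_variation_superadd:
  assumes \<nu>: "real_measure \<nu>" and "A \<in> sets half_borel" "C \<in> sets half_borel" "A \<inter> C = {}"
  shows "total_variation \<nu> A + total_variation \<nu> C \<le> total_variation \<nu> (A \<union> C)"
proof -
  let ?I = "\<lambda>A. {P. finite P \<and> disjoint P \<and> P \<subseteq> sets half_borel \<and> \<Union>P = A}"
  let ?S = "\<lambda>P. \<Sum>E\<in>P. ennreal \<bar>\<nu> E\<bar>"
  have ne: "?I A \<noteq> {}" if "A \<in> sets half_borel" for A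
  proof -
    have "{A} \<in> ?I A" using that by (simp add: disjoint_def)
    then show ?thesis by (metis (no_types, lifting) emptyE)
  qed
  have *: "?S P + ?S Q \<le> total_variation \<nu> (A \<union> C)" if P: "P \<in> ?I A" and Q: "Q \<in> ?I C" for P Q
  proof -
    have PQ: "E = {}" if "E \<in> P" "E \<in> Q" for E using P Q that assms by blast
    have "?S P + ?S Q = ?S (P \<union> Q)"
      using P Q PQ real_measure_empty[OF \<nu>] by (intro sum.union_inter_neutral[symmetric]) auto
    also have "\<dots> \<le> total_variation \<nu> (\<Union>(P \<union> Q))"
    proof (rule total_variation_upper)
      show "disjoint (P \<union> Q)"
        using P Q assms by (intro disjoint_union) auto
    qed (use P Q in auto)
    finally show ?thesis using P Q by auto
  qed
  have "?S P + total_variation \<nu> C \<le> total_variation \<nu> (A \<union> C)" if P: "P \<in> ?I A" for P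
  proof -
    have "?S P + total_variation \<nu> C = (SUP Q\<in>?I C. ?S P + ?S Q)"
      unfolding total_variation_def[of \<nu> C] by (rule ennreal_SUP_add_right[OF ne[OF assms(3)]])
    also have "\<dots> \<le> total_variation \<nu> (A \<union> C)"
      by (rule SUP_least) (rule *[OF P])
    finally show ?thesis .
  qed
  then have "(SUP P\<in>?I A. ?S P + total_variation \<nu> C) \<le> total_variation \<nu> (A \<union> C)"
    by (rule SUP_least)
  moreover have "(SUP P\<in>?I A. ?S P + total_variation \<nu> C) = total_variation \<nu> A + total_variation \<nu> C"
    unfolding total_variation_def[of \<nu> A] by (rule ennreal_SUP_add_left[OF ne[OF assms(2)]])
  ultimately show ?thesis by simp
qed

lemma total_variation_mono:
  assumes \<nu>: "real_measure \<nu>" and "A \<in> sets half_borel" "C \<in> sets half_borel" "A \<subseteq> C"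
  shows "total_variation \<nu> A \<le> total_variation \<nu> C"
proof -
  have "total_variation \<nu> A \<le> total_variation \<nu> A + total_variation \<nu> (C - A)" by simp
  also have "\<dots> \<le> total_variation \<nu> (A \<union> (C - A))"
    using assms by (intro total_variation_superadd) auto
  also have "A \<union> (C - A) = C" using assms by auto
  finally show ?thesis .
qed

lemma countably_additive_total_variation:
  assumes \<nu>: "real_measure \<nu>"
  shows "countably_additive (sets half_borel) (total_variation \<nu>)"
  unfolding countably_additive_def
proof (intro allI impI)
  fix A :: "nat \<Rightarrow> real set"
  assume A: "range A \<subseteq> sets half_borel" "disjoint_family A" "\<Union>(range A) \<in> sets half_borel"
  have mem: "A i \<in> sets half_borel" for i using A(1) by blast
  have memU: "(\<Union>i<n. A i) \<in> sets half_borel" for n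
    by (rule sets.finite_UN) (simp, rule mem)
  have "(\<Sum>n. total_variation \<nu> (A n)) \<le> total_variation \<nu> (\<Union>(range A))"
  proof (rule suminf_le_const[OF summableI])
    fix n
    have "(\<Sum>i<n. total_variation \<nu> (A i)) \<le> total_variation \<nu> (\<Union>i<n. A i)"
    proof (induction n)
      case (Suc n)
      have "(\<Sum>i<Suc n. total_variation \<nu> (A i)) \<le>
        total_variation \<nu> (\<Union>i<n. A i) + total_variation \<nu> (A n)"
        using Suc by (simp add: add_mono)
      also have "\<dots> \<le> total_variation \<nu> ((\<Union>i<n. A i) \<union> A n)"
      proof (rule total_variation_superadd[OF \<nu>])
        have "A i \<inter> A n = {}" if "i < n" for i
          using disjoint_family_onD[OF A(2) UNIV_I UNIV_I, of i n] that by simp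
        then show "(\<Union>i<n. A i) \<inter> A n = {}" by blast
        show "(\<Union>i<n. A i) \<in> sets half_borel" by (rule memU)
        show "A n \<in> sets half_borel" by (rule mem)
      qed
      also have "(\<Union>i<n. A i) \<union> A n = (\<Union>i<Suc n. A i)" by (auto simp: lessThan_Suc)
      finally show ?case .
    qed (simp add: total_variation_empty[OF \<nu>])
    also have "\<dots> \<le> total_variation \<nu> (\<Union>(range A))"
      by (rule total_variation_mono[OF \<nu> memU A(3)]) auto
    finally show "(\<Sum>i<n. total_variation \<nu> (A i)) \<le> total_variation \<nu> (\<Union>(range A))" .
  qed
  moreover have "total_variation \<nu> (\<Union>(range A)) \<le> (\<Sum>n. total_variation \<nu> (A n))"
    unfolding total_variation_def[of \<nu> "\<Union>(range A)"]
  proof (rule SUP_least)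
    fix P assume "P \<in> {P. finite P \<and> disjoint P \<and> P \<subseteq> sets half_borel \<and> \<Union>P = \<Union>(range A)}"
    then have P: "finite P" "disjoint P" "P \<subseteq> sets half_borel" "\<Union>P = \<Union>(range A)" by blast+
    have "ennreal \<bar>\<nu> E\<bar> \<le> (\<Sum>n. ennreal \<bar>\<nu> (E \<inter> A n)\<bar>)" if E: "E \<in> P" for E
    proof -
      have "(\<Union>n. E \<inter> A n) = E" using P(4) E by auto
      moreover have "(\<lambda>n. \<nu> (E \<inter> A n)) sums \<nu> (\<Union>n. E \<inter> A n)"
      proof (rule \<nu>[unfolded real_measure_def, rule_format])
        show "range (\<lambda>n. E \<inter> A n) \<subseteq> sets half_borel"
          using mem P(3) E by (blast intro: sets.Int)
        show "disjoint_family (\<lambda>n. E \<inter> A n)"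
          using A(2) by (auto simp: disjoint_family_on_def)
      qed
      ultimately have s: "(\<lambda>n. \<nu> (E \<inter> A n)) sums \<nu> E" by simp
      show ?thesis
      proof (cases "summable (\<lambda>n. \<bar>\<nu> (E \<inter> A n)\<bar>)")
        case True
        then have "\<bar>\<nu> E\<bar> \<le> (\<Sum>n. \<bar>\<nu> (E \<inter> A n)\<bar>)"
          using summable_rabs[OF True] sums_unique[OF s] by simp
        then show ?thesis
          by (simp add: suminf_ennreal2[OF _ True] ennreal_leI)
      next
        case False
        then have "(\<Sum>n. ennreal \<bar>\<nu> (E \<inter> A n)\<bar>) = top"
          using summable_suminf_not_top[of "\<lambda>n. \<bar>\<nu> (E \<inter> A n)\<bar>"] abs_ge_zero by blast
        then show ?thesis by simp
      qed
    qed
    then have "(\<Sum>E\<in>P. ennreal \<bar>\<nu> E\<bar>) \<le> (\<Sum>E\<in>P. \<Sum>n. ennreal \<bar>\<nu> (E \<inter> A n)\<bar>)"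
      by (rule sum_mono)
    also have "\<dots> = (\<Sum>n. \<Sum>E\<in>P. ennreal \<bar>\<nu> (E \<inter> A n)\<bar>)"
      by (rule suminf_sum[symmetric]) simp
    also have "\<dots> \<le> (\<Sum>n. total_variation \<nu> (A n))"
    proof (rule suminf_le)
      fix n
      let ?Q = "(\<lambda>E. E \<inter> A n) ` P"
      have dj: "E \<inter> E' = {}" if "E \<in> P" "E' \<in> P" "E \<noteq> E'" for E E'
        using P(2) that unfolding disjoint_def by blast
      have "(\<Sum>E\<in>P. ennreal \<bar>\<nu> (E \<inter> A n)\<bar>) = (\<Sum>E\<in>?Q. ennreal \<bar>\<nu> E\<bar>)"
      proof (rule sum.reindex_nontrivial[symmetric, unfolded o_def, OF P(1)])
        fix E E' assume "E \<in> P" "E' \<in> P" "E \<noteq> E'" "E \<inter> A n = E' \<inter> A n"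
        then have "E \<inter> A n = {}" using dj by blast
        then show "ennreal \<bar>\<nu> (E \<inter> A n)\<bar> = 0" using real_measure_empty[OF \<nu>] by simp
      qed
      also have "\<dots> \<le> total_variation \<nu> (\<Union>?Q)"
      proof (rule total_variation_upper)
        show "disjoint ?Q" using dj unfolding disjoint_def by fast
        show "?Q \<subseteq> sets half_borel" using mem P(3) by (blast intro: sets.Int)
      qed (use P(1) in auto)
      also have "\<Union>?Q = A n" using P(4) by auto
      finally show "(\<Sum>E\<in>P. ennreal \<bar>\<nu> (E \<inter> A n)\<bar>) \<le> total_variation \<nu> (A n)" .
    qed auto
    finally show "(\<Sum>E\<in>P. ennreal \<bar>\<nu> E\<bar>) \<le> (\<Sum>n. total_variation \<nu> (A n))" .
  qed
  ultimately show "(\<Sum>n. total_variation \<nu> (A n)) = total_variation \<nu> (\<Union>(range A))"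
    by (rule antisym)
qed

lemma emeasure_positive_part:
  assumes \<nu>: "real_measure \<nu>" and fin: "total_variation \<nu> {..0} < top" and A: "A \<in> sets half_borel"
  shows "emeasure (positive_part \<nu>) A = ennreal ((enn2real (total_variation \<nu> A) + \<nu> A) / 2)"
  unfolding positive_part_def
proof (rule emeasure_measure_of_sigma[OF _ _ _ A])
  let ?t = "\<lambda>A. enn2real (total_variation \<nu> A)"
  have fin': "total_variation \<nu> A < top" if "A \<in> sets half_borel" for A
  proof -
    have "{..0} \<in> sets half_borel" "A \<subseteq> {..0}"
      using sets.top[of half_borel] sets.sets_into_space[OF that] by (simp_all add: space_restrict_space)
    then show ?thesis
      using total_variation_mono[OF \<nu> that] fin by (blast intro: le_less_trans)
  qed
  have ge: "\<bar>\<nu> A\<bar> \<le> ?t A" if "A \<in> sets half_borel" for A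
    using total_variation_ge[OF that, of \<nu>] fin'[OF that]
    by (cases "total_variation \<nu> A") auto
  show "sigma_algebra {..0} (sets half_borel)"
    using sets.sigma_algebra_axioms[of half_borel] by (simp add: space_restrict_space)
  show "positive (sets half_borel) (\<lambda>A. ennreal ((?t A + \<nu> A) / 2))"
    using total_variation_empty[OF \<nu>] real_measure_empty[OF \<nu>] by (simp add: positive_def)
  show "countably_additive (sets half_borel) (\<lambda>A. ennreal ((?t A + \<nu> A) / 2))"
    unfolding countably_additive_def
  proof (intro allI impI)
    fix A :: "nat \<Rightarrow> real set"
    assume A: "range A \<subseteq> sets half_borel" "disjoint_family A" "\<Union>(range A) \<in> sets half_borel"
    have "(\<Sum>n. total_variation \<nu> (A n)) = total_variation \<nu> (\<Union>(range A))"
      using countably_additive_total_variation[OF \<nu>] A by (auto simp: countably_additive_def)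
    then have "(\<Sum>n. ennreal (?t (A n))) = ennreal (?t (\<Union>(range A)))"
      using fin' A by (simp add: ennreal_enn2real range_subsetD)
    then have "(\<lambda>n. ?t (A n)) sums ?t (\<Union>(range A))"
    proof -
      assume e: "(\<Sum>n. ennreal (?t (A n))) = ennreal (?t (\<Union>(range A)))"
      have s: "summable (\<lambda>n. ?t (A n))"
        by (rule summable_suminf_not_top) (simp_all add: e)
      have "ennreal (\<Sum>n. ?t (A n)) = ennreal (?t (\<Union>(range A)))"
        using suminf_ennreal2[OF enn2real_nonneg s] e by (rule trans[OF sym])
      then have "(\<Sum>n. ?t (A n)) = ?t (\<Union>(range A))"
        using ennreal_inj[OF suminf_nonneg[OF s enn2real_nonneg] enn2real_nonneg] by blast
      with summable_sums[OF s] show ?thesis by simp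
    qed
    moreover have "(\<lambda>n. \<nu> (A n)) sums \<nu> (\<Union>(range A))"
      using \<nu> A by (auto simp: real_measure_def)
    ultimately have s: "(\<lambda>n. (?t (A n) + \<nu> (A n)) / 2) sums ((?t (\<Union>(range A)) + \<nu> (\<Union>(range A))) / 2)"
      by (intro sums_divide sums_add)
    have "0 \<le> (?t (A n) + \<nu> (A n)) / 2" for n using ge[of "A n"] A(1) by (auto simp: range_subsetD)
    then show "(\<Sum>n. ennreal ((?t (A n) + \<nu> (A n)) / 2)) = ennreal ((?t (\<Union>(range A)) + \<nu> (\<Union>(range A))) / 2)"
      using s by (rule suminf_ennreal_eq)
  qed
qed

section \<open>Hypotheses on the operator\<close>

definition cond_D1 :: "('m::finite bu \<Rightarrow> real ^ 'm) \<Rightarrow> bool"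
  where "cond_D1 D \<longleftrightarrow> linear D \<and> continuous_on UNIV D"

definition cond_D2 :: "('m::finite bu \<Rightarrow> real ^ 'm) \<Rightarrow> bool"
  where "cond_D2 D \<longleftrightarrow>
    (\<forall>k>0. continuous_map (subtopology co_topology B\<^bsub>k\<^esub>) euclidean D)"

text \<open>
  Atomicity at \<open>0\<close> is stated through the integral representation, normalised so that the coefficient
  of \<open>x(0)\<close> is the identity matrix and the measures have no atom at \<open>0\<close>.
\<close>

definition cond_D3 :: "('m::finite bu \<Rightarrow> real ^ 'm) \<Rightarrow> bool"
  where "cond_D3 D \<longleftrightarrow>
    (\<exists>\<nu> :: 'm \<Rightarrow> 'm \<Rightarrow> real set \<Rightarrow> real.
      (\<forall>i j. real_measure (\<nu> i j) \<and> regular_measure (\<nu> i j) \<and>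
        total_variation (\<nu> i j) {..0} < \<infinity> \<and> total_variation (\<nu> i j) {0} = 0) \<and>
      (\<forall>x. D x = apply_bu x 0 -
        (\<chi> i. \<Sum>j\<in>UNIV. real_measure_integral (\<nu> i j) (\<lambda>s. apply_bu x s $ j))))"

definition cond_D4 :: "('m::finite bu \<Rightarrow> real ^ 'm) \<Rightarrow> bool"
  where "cond_D4 D \<longleftrightarrow>
    (\<exists>c :: real \<Rightarrow> real. continuous_on {0..} c \<and> (\<forall>t\<ge>0. 0 \<le> c t) \<and> (c \<longlongrightarrow> 0) at_top \<and>
      (\<forall>\<phi> x. D \<phi> = 0 \<longrightarrow>
        continuous_on UNIV x \<longrightarrow> (\<forall>s\<le>0. x s = apply_bu \<phi> s) \<longrightarrow> (\<forall>t\<ge>0. D (history x t) = 0) \<longrightarrow>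
        (\<forall>t\<ge>0. infnorm (x t) \<le> c t * norm \<phi>)))"

section \<open>The base flow and the right-hand side\<close>

definition continuous_flow :: "'w::metric_space set \<Rightarrow> (real \<Rightarrow> 'w \<Rightarrow> 'w) \<Rightarrow> bool"
  where "continuous_flow \<Omega> \<sigma> \<longleftrightarrow>
    continuous_on (UNIV \<times> \<Omega>) (\<lambda>(t, \<omega>). \<sigma> t \<omega>) \<and>
    (\<forall>t. \<forall>\<omega>\<in>\<Omega>. \<sigma> t \<omega> \<in> \<Omega>) \<and>
    (\<forall>\<omega>\<in>\<Omega>. \<sigma> 0 \<omega> = \<omega>) \<and>
    (\<forall>s t. \<forall>\<omega>\<in>\<Omega>. \<sigma> (s + t) \<omega> = \<sigma> s (\<sigma> t \<omega>))"

definition minimal_flow :: "'w::metric_space set \<Rightarrow> (real \<Rightarrow> 'w \<Rightarrow> 'w) \<Rightarrow> bool"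
  where "minimal_flow \<Omega> \<sigma> \<longleftrightarrow>
    continuous_flow \<Omega> \<sigma> \<and> compact \<Omega> \<and> \<Omega> \<noteq> {} \<and>
    (\<forall>M\<subseteq>\<Omega>. compact M \<longrightarrow> M \<noteq> {} \<longrightarrow> (\<forall>t. \<sigma> t ` M \<subseteq> M) \<longrightarrow> M = \<Omega>)"

text \<open>
  \<^const>\<open>local_lipschitz\<close> and \<^const>\<open>bounded\<close> refer to the Euclidean norm of the values of \<open>F\<close>, which
  is equivalent to the maximum norm; on the phase space the norm is the supremum norm.
\<close>

definition cond_F1 :: "'w::metric_space set \<Rightarrow> ('w \<Rightarrow> 'm::finite bu \<Rightarrow> real ^ 'm) \<Rightarrow> bool"
  where "cond_F1 \<Omega> F \<longleftrightarrow>
    continuous_on (\<Omega> \<times> UNIV) (\<lambda>(\<omega>, x). F \<omega> x) \<and> local_lipschitz \<Omega> UNIV F"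

definition cond_F2 :: "'w::metric_space set \<Rightarrow> ('w \<Rightarrow> 'm::finite bu \<Rightarrow> real ^ 'm) \<Rightarrow> bool"
  where "cond_F2 \<Omega> F \<longleftrightarrow> (\<forall>k>0. bounded ((\<lambda>(\<omega>, x). F \<omega> x) ` (\<Omega> \<times> B\<^bsub>k\<^esub>)))"

definition cond_F3 :: "'w::metric_space set \<Rightarrow> ('w \<Rightarrow> 'm::finite bu \<Rightarrow> real ^ 'm) \<Rightarrow> bool"
  where "cond_F3 \<Omega> F \<longleftrightarrow>
    (\<forall>k>0. continuous_map (prod_topology (top_of_set \<Omega>) (subtopology co_topology B\<^bsub>k\<^esub>))
      euclidean (\<lambda>(\<omega>, x). F \<omega> x))"

section \<open>Solutions and the induced local skew-product semiflow\<close>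

text \<open>Solutions on \<open>{..T}\<close>; at the end points of \<open>{0..T}\<close> the derivative is one-sided.\<close>

definition nfde_solution ::
  "('m::finite bu \<Rightarrow> real ^ 'm) \<Rightarrow> ('w \<Rightarrow> 'm bu \<Rightarrow> real ^ 'm) \<Rightarrow> (real \<Rightarrow> 'w \<Rightarrow> 'w) \<Rightarrow>
    'w \<Rightarrow> 'm bu \<Rightarrow> real \<Rightarrow> (real \<Rightarrow> real ^ 'm) \<Rightarrow> bool"
  where "nfde_solution D F \<sigma> \<omega> x T z \<longleftrightarrow>
    continuous_on {..T} z \<and> (\<forall>s\<le>0. z s = apply_bu x s) \<and>
    (\<forall>t\<in>{0..T}. ((\<lambda>t. D (history z t)) has_vector_derivative F (\<sigma> t \<omega>) (history z t))
      (at t within {0..T}))"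

definition nfde_time ::
  "('m::finite bu \<Rightarrow> real ^ 'm) \<Rightarrow> ('w \<Rightarrow> 'm bu \<Rightarrow> real ^ 'm) \<Rightarrow> (real \<Rightarrow> 'w \<Rightarrow> 'w) \<Rightarrow>
    'w \<Rightarrow> 'm bu \<Rightarrow> real set"
  where "nfde_time D F \<sigma> \<omega> x = {t. 0 \<le> t \<and> (\<exists>z. nfde_solution D F \<sigma> \<omega> x t z)}"

text \<open>
  The value \<open>z(t,\<omega>,x)\<close>. For \<open>t > 0\<close> it is meaningful for \<open>t \<in> nfde_time D F \<sigma> \<omega> x\<close>, where it does not
  depend on the choice because solutions are unique.
\<close>

definition nfde_z ::
  "('m::finite bu \<Rightarrow> real ^ 'm) \<Rightarrow> ('w \<Rightarrow> 'm bu \<Rightarrow> real ^ 'm) \<Rightarrow> (real \<Rightarrow> 'w \<Rightarrow> 'w) \<Rightarrow>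
    real \<Rightarrow> 'w \<Rightarrow> 'm bu \<Rightarrow> real ^ 'm"
  where "nfde_z D F \<sigma> t \<omega> x =
    (if t \<le> 0 then apply_bu x t else (SOME z. nfde_solution D F \<sigma> \<omega> x t z) t)"

definition nfde_u ::
  "('m::finite bu \<Rightarrow> real ^ 'm) \<Rightarrow> ('w \<Rightarrow> 'm bu \<Rightarrow> real ^ 'm) \<Rightarrow> (real \<Rightarrow> 'w \<Rightarrow> 'w) \<Rightarrow>
    real \<Rightarrow> 'w \<Rightarrow> 'm bu \<Rightarrow> 'm bu"
  where "nfde_u D F \<sigma> t \<omega> x = history (\<lambda>r. nfde_z D F \<sigma> r \<omega> x) t"

definition nfde_tau ::
  "('m::finite bu \<Rightarrow> real ^ 'm) \<Rightarrow> ('w \<Rightarrow> 'm bu \<Rightarrow> real ^ 'm) \<Rightarrow> (real \<Rightarrow> 'w \<Rightarrow> 'w) \<Rightarrow>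
    real \<Rightarrow> 'w \<times> 'm bu \<Rightarrow> 'w \<times> 'm bu"
  where "nfde_tau D F \<sigma> t = (\<lambda>(\<omega>, x). (\<sigma> t \<omega>, nfde_u D F \<sigma> t \<omega> x))"

definition backward_orbit_extension ::
  "('m::finite bu \<Rightarrow> real ^ 'm) \<Rightarrow> ('w::metric_space \<Rightarrow> 'm bu \<Rightarrow> real ^ 'm) \<Rightarrow> 'w set \<Rightarrow>
    (real \<Rightarrow> 'w \<Rightarrow> 'w) \<Rightarrow> 'w \<Rightarrow> 'm bu \<Rightarrow> (real \<Rightarrow> 'w \<times> 'm bu) \<Rightarrow> bool"
  where "backward_orbit_extension D F \<Omega> \<sigma> \<omega> x \<psi> \<longleftrightarrow>
    continuous_on {..0} \<psi> \<and> \<psi> ` {..0} \<subseteq> \<Omega> \<times> UNIV \<and> \<psi> 0 = (\<omega>, x) \<and>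
    (\<forall>s\<le>0. \<forall>t\<in>{0..- s}. t \<in> nfde_time D F \<sigma> (fst (\<psi> s)) (snd (\<psi> s)) \<and>
      nfde_tau D F \<sigma> t (\<psi> s) = \<psi> (s + t))"

end

theory Submission
  imports Defs
begin

text \<open>
  Let \<open>g t = F (\<sigma> t \<omega>) z\<^sub>t\<close>. The equation says that \<open>t \<mapsto> D z\<^sub>t\<close> is of class \<open>C\<^sup>1\<close> with derivative \<open>g\<close>,
  which is bounded because the orbit is bounded. The question is whether the regularity of \<open>D z\<^sub>t\<close>
  passes to \<open>z\<close> itself. For a neutral equation this is false on a half-line, where kinks of the initial
  function are propagated forever, but it is true on the whole line: a bounded function on \<open>{..t}\<close> is
  determined by its images under \<open>D\<close>, because the influence of the remote past is damped by the
  stability of \<open>D\<close>.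

  Quantitatively, for every \<open>\<eta> > 0\<close> there are \<open>\<tau>\<close> and \<open>K\<close> such that, in the maximum norm,
  \<open>\<bar>v(0)\<bar> \<le> \<eta> * norm v + K * sup {\<bar>D v\<^sub>r\<bar>. - \<tau> \<le> r \<le> 0}\<close> for all \<open>v\<close> in the phase space
  (\<open>stable_local_estimate\<close>). Taking \<open>\<eta> = 1/2\<close> and the supremum over translates, \<open>norm v\<close> is bounded by a
  multiple of \<open>sup {\<bar>D v\<^sub>r\<bar>. r \<le> 0}\<close> (\<open>stable_global_estimate\<close>). Apply this to the difference quotients
  of \<open>t \<mapsto> z\<^sub>t\<close>, whose images under \<open>D\<close> are the difference quotients of \<open>D z\<^sub>t\<close>: these
  are bounded and converge to \<open>g\<close> locally uniformly. The global estimate then bounds the quotients of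
  \<open>z\<^sub>t\<close>, and the local one shows that those of \<open>z\<close> are locally uniformly Cauchy, so \<open>z\<close> is of
  class \<open>C\<^sup>1\<close> (\<open>stable_C1_inverse\<close>).

  To prove the local estimate, \<open>v\<close> is compared with a solution of \<open>D x\<^sub>t = 0\<close> that starts close to
  \<open>v\<close> at time \<open>-\<tau>\<close>: stability makes \<open>x\<close> small at time \<open>0\<close>, and the error is controlled on bounded time
  intervals. Existence of \<open>x\<close> (\<open>homogeneous_solution_exists\<close>) and control of the error
  (\<open>neutral_gronwall\<close>) both rest on atomicity at \<open>0\<close> in the form that \<open>D w\<close> is close to \<open>w(0)\<close> in
  a norm with a steep exponential weight (\<open>atomic_imp_exp_atomic\<close>). The same device proves that initial
  value problems have unique solutions, so that \<^const>\<open>nfde_z\<close> is one single solution on the whole line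
  (\<open>entire_orbit\<close>).
\<close>

section \<open>Paths with histories in the phase space\<close>

text \<open>
  Outside its domain the abstraction map \<^const>\<open>Bu\<close> is unspecified, so \<^term>\<open>history z t\<close> describes \<open>z\<close>
  only for paths with a genuine history at time \<open>t\<close>. The predicate singles these out without reference
  to an initial segment at time \<open>0\<close>, so that it is stable under time shifts.
\<close>

definition bu_path :: "real \<Rightarrow> (real \<Rightarrow> real ^ 'm::finite) \<Rightarrow> bool"
  where "bu_path T z \<longleftrightarrow> uniformly_continuous_on {..T} z \<and> bounded (z ` {..T})"

lemma bu_path_mono: "bu_path T z \<Longrightarrow> t \<le> T \<Longrightarrow> bu_path t z"
  unfolding bu_path_def uniformly_continuous_on_def
  by (meson atMost_subset_iff bounded_subset image_mono subsetD)

lemma bu_path_cong: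
  assumes "bu_path T y" "\<And>t. t \<le> T \<Longrightarrow> y t = z t"
  shows "bu_path T z"
proof -
  have "z ` {..T} = y ` {..T}"
    using assms(2) by (intro image_cong) auto
  then show ?thesis
    using assms unfolding bu_path_def uniformly_continuous_on_def by simp
qed

lemma bu_path_diff: "bu_path T y \<Longrightarrow> bu_path T z \<Longrightarrow> bu_path T (\<lambda>t. y t - z t)"
  unfolding bu_path_def by (auto intro: uniformly_continuous_on_diff bounded_minus_comp)

lemma bu_path_imp_continuous: "bu_path T z \<Longrightarrow> continuous_on {..T} z"
  unfolding bu_path_def using uniformly_continuous_imp_continuous by blast

lemma bu_path_shift:
  assumes z: "bu_path (T + a) z"
  shows "bu_path T (\<lambda>t. z (t + a))"
  unfolding bu_path_def uniformly_continuous_on_def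
proof (intro conjI allI impI)
  fix e :: real assume "0 < e"
  then obtain d where d: "d > 0"
    "\<And>s t. s \<le> T + a \<Longrightarrow> t \<le> T + a \<Longrightarrow> dist t s < d \<Longrightarrow> dist (z t) (z s) < e"
    using z unfolding bu_path_def uniformly_continuous_on_def by (metis atMost_iff)
  have "dist (z (t + a)) (z (s + a)) < e" if "s \<le> T" "t \<le> T" "dist t s < d" for s t
    using d(2)[of "s + a" "t + a"] that by simp
  then show "\<exists>d>0. \<forall>s\<in>{..T}. \<forall>t\<in>{..T}. dist t s < d \<longrightarrow> dist (z (t + a)) (z (s + a)) < e"
    using d(1) by auto
next
  have "bounded (z ` {..T + a})"
    using z by (simp add: bu_path_def)
  then show "bounded ((\<lambda>t. z (t + a)) ` {..T})"
    by (rule bounded_subset) auto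
qed

lemma apply_history_path:
  assumes z: "bu_path t z"
  shows "apply_bu (history z t) s = z (t + min s 0)"
proof -
  have "bu_path 0 (\<lambda>s. z (s + t))"
    using z by (intro bu_path_shift) simp
  then have "bu_path 0 (\<lambda>s. z (t + min s 0))"
    by (rule bu_path_cong) (simp add: add.commute)
  then show ?thesis
    unfolding history_def bu_path_def by (subst Bu_inverse) auto
qed

lemma bu_path_extension:
  assumes z: "continuous_on {..T} z" and \<phi>: "\<And>s. s \<le> 0 \<Longrightarrow> z s = apply_bu \<phi> s"
  shows "bu_path T z"
proof -
  let ?h = "apply_bu (history z T)"
  have h: "?h s = z (T + min s 0)" for s
    using apply_history[OF assms] .
  have "bu_path 0 ?h"
    by (simp add: bu_path_def uniformly_continuous_on_apply_bu bounded_apply_bu)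
  then have "bu_path T (\<lambda>t. ?h (t + - T))"
    by (intro bu_path_shift) simp
  then show ?thesis
    by (rule bu_path_cong) (simp add: h)
qed

lemma apply_bu_min: "apply_bu \<phi> s = apply_bu \<phi> (min s 0)"
  by transfer (auto simp: min_def)

lemma continuous_on_apply_bu: "continuous_on S (apply_bu \<phi>)"
proof -
  have "continuous_on UNIV (\<lambda>s. apply_bu \<phi> (min s 0))"
  proof (rule continuous_on_compose2[of "{..0}" "apply_bu \<phi>"])
    show "continuous_on {..0} (apply_bu \<phi>)"
      by (rule uniformly_continuous_imp_continuous[OF uniformly_continuous_on_apply_bu])
  qed (auto intro!: continuous_intros)
  then show ?thesis
    unfolding apply_bu_min[symmetric] using continuous_on_subset by blast
qed

lemma bu_path_apply_bu: "bu_path T (apply_bu \<phi>)"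
  by (rule bu_path_extension) (auto intro: continuous_on_apply_bu)

lemma history_cong: "(\<And>s. s \<le> t \<Longrightarrow> y s = z s) \<Longrightarrow> history y t = history z t"
  unfolding history_def by (rule arg_cong[of _ _ Bu]) auto

lemma history_apply_bu_0: "history (apply_bu \<phi>) 0 = \<phi>"
  by (rule bu_eqI) (simp add: apply_history_path[OF bu_path_apply_bu])

lemma history_diff:
  assumes "bu_path t y" "bu_path t z"
  shows "history (\<lambda>s. y s - z s) t = history y t - history z t"
  by (rule bu_eqI) (simp add: apply_history_path assms bu_path_diff minus_bu.rep_eq)

lemma history_history:
  assumes z: "bu_path t z" and r: "r \<le> 0"
  shows "history (apply_bu (history z t)) r = history z (t + r)"
proof (rule bu_eqI)
  fix s :: real assume "s \<le> 0"
  moreover have "bu_path (t + r) z"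
    using bu_path_mono[OF z] r by simp
  ultimately show "apply_bu (history (apply_bu (history z t)) r) s = apply_bu (history z (t + r)) s"
    using r by (simp add: apply_history_path bu_path_apply_bu z algebra_simps)
qed

lemma norm_history_le:
  assumes "bu_path t z" "\<And>s. s \<le> t \<Longrightarrow> infnorm (z s) \<le> b"
  shows "norm (history z t) \<le> b"
  using assms by (intro norm_bu_le) (simp add: apply_history_path)

lemma norm_history_apply_bu_le: "norm (history (apply_bu \<phi>) t) \<le> norm \<phi>"
proof (rule norm_history_le[OF bu_path_apply_bu])
  fix s show "infnorm (apply_bu \<phi> s) \<le> norm \<phi>"
    using infnorm_le_norm_bu[of "min s 0" \<phi>] apply_bu_min[of \<phi> s] by simp
qed

lemma continuous_on_history:
  assumes z: "bu_path T z"
  shows "continuous_on {..T} (history z)"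
  unfolding continuous_on_iff
proof (intro ballI allI impI)
  fix t and e :: real assume t: "t \<in> {..T}" and e: "0 < e"
  obtain d where d: "d > 0" "\<And>a b. a \<le> T \<Longrightarrow> b \<le> T \<Longrightarrow> dist b a < d \<Longrightarrow> dist (z b) (z a) < e / 2"
    using z e unfolding bu_path_def uniformly_continuous_on_def by (metis atMost_iff half_gt_zero)
  show "\<exists>d>0. \<forall>t'\<in>{..T}. dist t' t < d \<longrightarrow> dist (history z t') (history z t) < e"
  proof (intro exI[of _ d] conjI ballI impI \<open>d > 0\<close>)
    fix t' assume t': "t' \<in> {..T}" "dist t' t < d"
    have p: "bu_path t z" "bu_path t' z"
      using z t t' by (auto intro: bu_path_mono)
    have "norm (history z t' - history z t) \<le> e / 2"
    proof (rule norm_bu_le)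
      fix s :: real assume s: "s \<le> 0"
      have "norm (z (t' + s) - z (t + s)) < e / 2"
        using d(2)[of "t + s" "t' + s"] t t' s by (simp add: dist_norm)
      then show "infnorm (apply_bu (history z t' - history z t) s) \<le> e / 2"
        using infnorm_le_norm[of "z (t' + s) - z (t + s)"] s
        by (simp add: minus_bu.rep_eq apply_history_path p)
    qed
    then show "dist (history z t') (history z t) < e"
      using e by (simp add: dist_norm)
  qed
qed

lemma continuous_on_UNIV_if_atMost:
  fixes f :: "real \<Rightarrow> 'a::topological_space"
  assumes "\<And>T. continuous_on {..T} f"
  shows "continuous_on UNIV f"
proof -
  have "continuous_on (\<Union>T. {..<T}) f"
  proof (rule continuous_on_open_UN)
    show "continuous_on {..<T} f" for T
      by (rule continuous_on_subset[OF assms[of T]]) auto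
  qed simp
  moreover have "(\<Union>T. {..<T::real}) = UNIV"
    by (auto simp: gt_ex)
  ultimately show ?thesis by simp
qed

lemma continuous_on_UNIV_history: "(\<And>T. bu_path T z) \<Longrightarrow> continuous_on UNIV (history z)"
  by (intro continuous_on_UNIV_if_atMost continuous_on_history)

section \<open>Atomicity at zero, in exponentially weighted form\<close>

lemma finite_positive_part:
  assumes "real_measure \<nu>" "total_variation \<nu> {..0} < \<infinity>"
  shows "finite_measure (positive_part \<nu>)" "sets (positive_part \<nu>) = sets half_borel"
    "space (positive_part \<nu>) = {..0}"
proof -
  show space: "space (positive_part \<nu>) = {..0}"
    unfolding positive_part_def by (rule space_measure_of) (use sets.space_closed[of half_borel] in \<open>simp add: space_restrict_space\<close>)
  have "sigma_algebra {..0} (sets half_borel)"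
    using sets.sigma_algebra_axioms[of half_borel] by (simp add: space_restrict_space)
  then show "sets (positive_part \<nu>) = sets half_borel"
    unfolding positive_part_def by (rule sigma_algebra.sets_measure_of_eq)
  have "{..0} \<in> sets half_borel"
    using sets.top[of half_borel] by (simp add: space_restrict_space)
  then show "finite_measure (positive_part \<nu>)"
    by (intro finite_measureI) (use assms in \<open>simp add: space emeasure_positive_part\<close>)
qed

text \<open>
  As \<open>n \<rightarrow> \<infinity>\<close> the weights decrease to the indicator function of \<open>{0}\<close>, and \<open>\<nu>\<close> has no atom there.
\<close>

lemma tendsto_exp_integral_positive_part:
  assumes \<nu>: "real_measure \<nu>" "total_variation \<nu> {..0} < \<infinity>" and atom: "total_variation \<nu> {0} = 0"
  shows "integrable (positive_part \<nu>) (\<lambda>s. exp (real n * s))"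
    and "(\<lambda>n. LINT s|positive_part \<nu>. exp (real n * s)) \<longlonglongrightarrow> 0"
proof -
  let ?M = "positive_part \<nu>"
  interpret finite_measure ?M using finite_positive_part[OF \<nu>] by simp
  note s = finite_positive_part(2,3)[OF \<nu>]
  have 0: "{0} \<in> sets half_borel" by (subst sets_restrict_space_iff) auto
  have "\<nu> {0} = 0"
    using total_variation_ge[OF 0, of \<nu>] atom by simp
  then have "emeasure ?M {0} = 0"
    using emeasure_positive_part[OF \<nu>(1) _ 0] \<nu>(2) atom by simp
  then have ae: "AE s in ?M. s \<noteq> 0"
  proof (rule AE_I[rotated])
    show "{0} \<in> sets ?M" using 0 by (simp only: s(1))
  qed blast
  have m: "(\<lambda>s. exp (real n * s)) \<in> borel_measurable ?M" for n
    unfolding measurable_cong_sets[OF s(1) refl] by (intro measurable_restrict_space1) simp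
  show "integrable ?M (\<lambda>s. exp (real n * s))"
    by (rule integrable_const_bound[OF _ m, of _ 1]) (auto simp: s mult_nonneg_nonpos intro!: AE_I2)
  have "(\<lambda>n. LINT s|?M. exp (real n * s)) \<longlonglongrightarrow> (LINT s|?M. 0)"
  proof (rule integral_dominated_convergence[where w = "\<lambda>_. 1"])
    show "AE s in ?M. (\<lambda>n. exp (real n * s)) \<longlonglongrightarrow> 0"
      using ae
    proof (rule AE_mp, intro AE_I2 impI)
      fix s assume "s \<in> space ?M" "s \<noteq> 0"
      then have "exp s < 1" by (simp add: s)
      then show "(\<lambda>n. exp (real n * s)) \<longlonglongrightarrow> 0"
        unfolding exp_of_nat_mult by (intro LIMSEQ_power_zero) simp
    qed
    show "AE s in ?M. norm (exp (real n * s)) \<le> 1" for n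
      by (rule AE_I2) (auto simp: s mult_nonneg_nonpos)
  qed (use m in auto)
  then show "(\<lambda>n. LINT s|?M. exp (real n * s)) \<longlonglongrightarrow> 0" by simp
qed

lemma abs_integral_le:
  fixes f g :: "'a \<Rightarrow> real"
  assumes g: "integrable M g" and fg: "\<And>s. s \<in> space M \<Longrightarrow> \<bar>f s\<bar> \<le> g s"
  shows "\<bar>LINT s|M. f s\<bar> \<le> (LINT s|M. g s)"
proof -
  have "\<bar>LINT s|M. f s\<bar> \<le> (LINT s|M. \<bar>f s\<bar>)"
    by (rule integral_abs_bound)
  also have "\<dots> \<le> (LINT s|M. g s)"
    using g fg abs_ge_zero order_trans by (intro integral_mono') blast+
  finally show ?thesis .
qed

lemma real_measure_uminus: "real_measure \<nu> \<Longrightarrow> real_measure (\<lambda>A. - \<nu> A)"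
  unfolding real_measure_def by (auto intro: sums_minus)

lemma total_variation_uminus: "total_variation (\<lambda>A. - \<nu> A) = total_variation \<nu>"
  unfolding total_variation_def by simp

text \<open>
  Smallness of \<open>w \<mapsto> w(0) - D w\<close> in the norm with weight \<open>exp (l * s)\<close>, \<open>s \<le> 0\<close>. The usual form of
  atomicity, smallness on functions supported in a short interval \<open>{-d..0}\<close>, gives existence and
  estimates on time intervals of length \<open>d\<close> that then have to be concatenated; the weighted form
  yields them on the whole half-line at once, in the norm \<open>sup\<^sub>t exp (- l * t) * norm (z t)\<close>.
\<close>

definition exp_atomic :: "real \<Rightarrow> real \<Rightarrow> ('m::finite bu \<Rightarrow> real ^ 'm) \<Rightarrow> bool"
  where "exp_atomic l e D \<longleftrightarrow>
    (\<forall>w b. (\<forall>s\<le>0. norm (apply_bu w s) \<le> b * exp (l * s)) \<longrightarrow> norm (apply_bu w 0 - D w) \<le> e * b)"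

text \<open>
  The \<open>(i,j)\<close> entry of \<open>w(0) - D w\<close> is at most \<open>b\<close> times the integral of \<open>exp (l * s)\<close> against \<open>\<bar>\<nu>\<^sub>i\<^sub>j\<bar>\<close>, and
  this integral is small for large \<open>l\<close>.
\<close>

lemma atomic_imp_exp_atomic:
  assumes D: "cond_D3 D" and e: "0 < e"
  obtains l0 where "0 < l0" "\<And>l. l0 \<le> l \<Longrightarrow> exp_atomic l e D"
proof -
  obtain \<nu> where cond: "\<forall>i j. real_measure (\<nu> i j) \<and> regular_measure (\<nu> i j) \<and>
        total_variation (\<nu> i j) {..0} < \<infinity> \<and> total_variation (\<nu> i j) {0} = 0"
    and rep': "\<forall>x. D x = apply_bu x 0 -
        (\<chi> i. \<Sum>j\<in>UNIV. real_measure_integral (\<nu> i j) (\<lambda>s. apply_bu x s $ j))"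
    using D unfolding cond_D3_def by (elim exE conjE)
  have rep: "D x = apply_bu x 0 -
        (\<chi> i. \<Sum>j\<in>UNIV. real_measure_integral (\<nu> i j) (\<lambda>s. apply_bu x s $ j))" for x
    by (rule spec[OF rep'])
  have \<nu>: "real_measure (\<nu> i j)" "total_variation (\<nu> i j) {..0} < \<infinity>"
      "total_variation (\<nu> i j) {0} = 0" for i j
    using cond by simp_all
  define I where "I \<nu> n = (LINT s|positive_part \<nu>. exp (real n * s))" for \<nu> and n :: nat
  let ?J = "\<lambda>n. \<Sum>i\<in>UNIV. \<Sum>j\<in>UNIV. I (\<nu> i j) n + I (\<lambda>A. - \<nu> i j A) n"
  have neg: "real_measure (\<lambda>A. - \<nu> i j A)" "total_variation (\<lambda>A. - \<nu> i j A) {..0} < \<infinity>"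
      "total_variation (\<lambda>A. - \<nu> i j A) {0} = 0" for i j
    unfolding total_variation_uminus by (rule real_measure_uminus[OF \<nu>(1)] \<nu>)+
  have "?J \<longlonglongrightarrow> (\<Sum>i\<in>(UNIV::'a set). \<Sum>j\<in>(UNIV::'a set). 0 + 0)"
    unfolding I_def
    by (intro tendsto_sum tendsto_add tendsto_exp_integral_positive_part(2) \<nu> neg)
  then have "eventually (\<lambda>n. ?J n < e) sequentially"
    using e by (auto dest: order_tendstoD)
  then have "eventually (\<lambda>n. ?J n < e \<and> 0 < n) sequentially"
    by (intro eventually_conj eventually_gt_at_top)
  then obtain n where n: "?J n < e" "0 < n"
    by (auto simp: eventually_sequentially)
  show thesis
  proof (rule that[of "real n"])
    fix l :: real
    assume l: "real n \<le> l"
    show "exp_atomic l e D"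
      unfolding exp_atomic_def
    proof (intro allI impI)
      fix w :: "'a bu" and b
      assume W: "\<forall>s\<le>0. norm (apply_bu w s) \<le> b * exp (l * s)"
      then have w: "norm (apply_bu w s) \<le> b * exp (l * s)" if "s \<le> 0" for s
        using that by blast
      have b: "0 \<le> b"
        using order_trans[OF norm_ge_zero w[of 0]] by simp
      have w': "norm (apply_bu w s) \<le> b * exp (real n * s)" if "s \<le> 0" for s
      proof -
        have "exp (l * s) \<le> exp (real n * s)"
          using l that by (simp add: mult_right_mono_neg)
        then show ?thesis
          using w[OF that] mult_left_mono[OF _ b] by fastforce
      qed
      have part: "\<bar>LINT s|positive_part \<mu>. apply_bu w s $ j\<bar> \<le> b * I \<mu> n"
        if \<mu>: "real_measure \<mu>" "total_variation \<mu> {..0} < \<infinity>" "total_variation \<mu> {0} = 0" for \<mu> j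
      proof -
        have "\<bar>LINT s|positive_part \<mu>. apply_bu w s $ j\<bar> \<le> (LINT s|positive_part \<mu>. b * exp (real n * s))"
        proof (rule abs_integral_le)
          show "integrable (positive_part \<mu>) (\<lambda>s. b * exp (real n * s))"
            using tendsto_exp_integral_positive_part(1)[OF \<mu>] by simp
          fix s assume "s \<in> space (positive_part \<mu>)"
          then show "\<bar>apply_bu w s $ j\<bar> \<le> b * exp (real n * s)"
            using w'[of s] component_le_norm_cart[of "apply_bu w s" j]
            by (simp add: finite_positive_part(3)[OF \<mu>(1,2)])
        qed
        then show ?thesis by (simp add: I_def)
      qed
      have ij: "\<bar>real_measure_integral (\<nu> i j) (\<lambda>s. apply_bu w s $ j)\<bar>
          \<le> b * (I (\<nu> i j) n + I (\<lambda>A. - \<nu> i j A) n)" for i j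
        using part[OF \<nu>, of i j j] part[OF neg, of i j j]
        unfolding real_measure_integral_def distrib_left by linarith
      let ?v = "\<chi> i. \<Sum>j\<in>UNIV. real_measure_integral (\<nu> i j) (\<lambda>s. apply_bu w s $ j)"
      have "norm (apply_bu w 0 - D w) = norm ?v"
        by (simp add: rep)
      also have "\<dots> \<le> (\<Sum>i\<in>UNIV. \<bar>?v $ i\<bar>)"
        by (rule norm_le_l1_cart)
      also have "\<dots> \<le> (\<Sum>i\<in>UNIV. \<Sum>j\<in>UNIV. b * (I (\<nu> i j) n + I (\<lambda>A. - \<nu> i j A) n))"
      proof (rule sum_mono)
        fix i
        have "\<bar>?v $ i\<bar> \<le> (\<Sum>j\<in>UNIV. \<bar>real_measure_integral (\<nu> i j) (\<lambda>s. apply_bu w s $ j)\<bar>)"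
          by simp
        also have "\<dots> \<le> (\<Sum>j\<in>UNIV. b * (I (\<nu> i j) n + I (\<lambda>A. - \<nu> i j A) n))"
          by (rule sum_mono) (rule ij)
        finally show "\<bar>?v $ i\<bar> \<le> (\<Sum>j\<in>UNIV. b * (I (\<nu> i j) n + I (\<lambda>A. - \<nu> i j A) n))" .
      qed
      also have "\<dots> = b * ?J n"
        by (simp add: sum_distrib_left)
      also have "\<dots> \<le> b * e"
        using n b by (intro mult_left_mono) auto
      finally show "norm (apply_bu w 0 - D w) \<le> e * b"
        by (simp add: mult.commute)
    qed
  qed (use n in simp)
qed

section \<open>Linear equations: existence and growth of solutions\<close>

lemma cond_D1_bound:
  assumes "cond_D1 D"
  obtains M where "0 \<le> M" "\<And>x. norm (D x) \<le> M * norm x"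
proof -
  have lin: "linear D" and "isCont D 0"
    using assms by (auto simp: cond_D1_def continuous_on_eq_continuous_at)
  then obtain d where d: "0 < d" "\<And>x. norm x < d \<Longrightarrow> norm (D x) < 1"
    using linear_0[OF lin] unfolding continuous_at_eps_delta dist_norm
    by (metis diff_zero zero_less_one)
  have "norm (D x) \<le> (2 / d) * norm x" for x
  proof (cases "x = 0")
    case False
    then have "norm (D ((d / (2 * norm x)) *\<^sub>R x)) < 1"
      using d(1) by (intro d(2)) (simp add: field_simps)
    then show ?thesis
      using False d(1) by (simp add: linear_scale[OF lin] field_simps)
  qed (simp add: linear_0[OF lin])
  then show thesis
    using d(1) by (intro that[of "2 / d"]) auto
qed

text \<open>
  Translating the path by \<open>t\<close> multiplies the weight by the constant \<open>exp (l * t)\<close>, so the bound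
  \<^const>\<open>exp_atomic\<close> for functions on the half-line transfers to every time with the same constant \<open>e\<close>.
\<close>

lemma weighted_atomic_estimate:
  assumes D: "exp_atomic l e D"
    and w: "bu_path t w" and b: "\<And>s. s \<le> t \<Longrightarrow> norm (w s) \<le> b * exp (l * s)"
  shows "norm (w t - D (history w t)) \<le> e * b * exp (l * t)"
proof -
  have "norm (apply_bu (history w t) s) \<le> (b * exp (l * t)) * exp (l * s)" if "s \<le> 0" for s
    using b[of "t + s"] that by (simp add: apply_history_path[OF w] distrib_left exp_add mult.assoc)
  then have "norm (apply_bu (history w t) 0 - D (history w t)) \<le> e * (b * exp (l * t))"
    using D unfolding exp_atomic_def by blast
  then show ?thesis
    by (simp add: apply_history_path[OF w] mult.assoc)
qed

text \<open>
  Continue \<open>\<phi>\<close> by the constant \<open>\<phi>(0)\<close> and look for \<open>x(t) = \<phi>(t) + exp (l * t) * q(t)\<close> with \<open>q\<close> bounded and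
  continuous. In terms of \<open>q\<close> the equation \<open>D x\<^sub>t = 0\<close> is the fixed point equation of an operator on the
  Banach space of bounded continuous functions that the choice of \<open>l\<close> makes a contraction.
\<close>

lemma homogeneous_solution_exists:
  assumes D1: "cond_D1 D" and D3: "cond_D3 D" and \<phi>: "D \<phi> = 0"
  obtains x where "continuous_on UNIV x" "\<And>s. s \<le> 0 \<Longrightarrow> x s = apply_bu \<phi> s"
    "\<And>t. 0 \<le> t \<Longrightarrow> D (history x t) = 0"
proof -
  have lin: "linear D" and cont: "continuous_on UNIV D"
    using D1 by (auto simp: cond_D1_def)
  obtain M where M: "0 \<le> M" "\<And>x. norm (D x) \<le> M * norm x"
    using cond_D1_bound[OF D1] by blast
  obtain l where l: "0 < l" and atomic: "exp_atomic l (1/4) D"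
    using atomic_imp_exp_atomic[OF D3, of "1/4"] by (metis order_refl zero_less_divide_1_iff zero_less_numeral)
  \<comment> \<open>Subtracting \<open>q 0\<close> makes \<open>W q\<close> vanish on \<open>{..0}\<close> without restricting \<open>q\<close> to a subspace; the fixed
    point satisfies \<open>q 0 = 0\<close>, because \<open>D \<phi> = 0\<close>.\<close>
  define W where "W q t = exp (l * t) *\<^sub>R (apply_bcontfun q (max t 0) - apply_bcontfun q 0)"
    for q :: "real \<Rightarrow>\<^sub>C (real ^ 'a)" and t
  define X where "X q t = apply_bu \<phi> t + W q t" for q t
  have W0: "W q s = 0" if "s \<le> 0" for q s
    using that by (simp add: W_def max_def)
  have contW: "continuous_on S (W q)" for q S
    unfolding W_def
    by (intro continuous_intros continuous_on_compose2[OF continuous_on_apply_bcontfun[of UNIV q]]) auto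
  have pW: "bu_path T (W q)" for q T
    by (rule bu_path_extension[OF contW, where \<phi> = 0]) (simp add: W0 zero_bu.rep_eq)
  have contX: "continuous_on S (X q)" for q S
    unfolding X_def by (intro continuous_intros contW continuous_on_apply_bu)
  have X\<phi>: "X q s = apply_bu \<phi> s" if "s \<le> 0" for q s
    using that by (simp add: X_def W0)
  have pX: "bu_path T (X q)" for q T
    by (rule bu_path_extension[OF contX]) (simp add: X\<phi>)
  have "W q = (\<lambda>t. X q t - apply_bu \<phi> t)" for q
    by (simp add: X_def fun_eq_iff)
  then have "history (W q) t = history (X q) t - history (apply_bu \<phi>) t" for q t
    using history_diff[OF pX bu_path_apply_bu] by simp
  then have DX: "D (history (X q) t) = D (history (W q) t) + D (history (apply_bu \<phi>) t)" for q t
    by (simp add: linear_diff[OF lin])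
  have estW: "norm (exp (- l * t) *\<^sub>R (W q t - D (history (W q) t))) \<le> norm q / 2" for q t
  proof -
    have "norm (W q s) \<le> (2 * norm q) * exp (l * s)" for s
    proof -
      have "norm (apply_bcontfun q (max s 0) - apply_bcontfun q 0) \<le> 2 * norm q"
        using norm_triangle_ineq4[of "apply_bcontfun q (max s 0)" "apply_bcontfun q 0"]
          norm_bounded[of q "max s 0"] norm_bounded[of q 0] by linarith
      then show ?thesis
        by (simp add: W_def mult.commute)
    qed
    then have "norm (W q t - D (history (W q) t)) \<le> 1/4 * (2 * norm q) * exp (l * t)"
      by (intro weighted_atomic_estimate[OF atomic pW])
    then show ?thesis
      unfolding norm_scaleR by (simp add: exp_minus divide_simps mult.commute)
  qed
  define T where "T q t = exp (- l * max t 0) *\<^sub>R (W q (max t 0) - D (history (X q) (max t 0)))" for q t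
  have contT: "continuous_on UNIV (T q)" for q
  proof -
    have "continuous_on UNIV (\<lambda>t. D (history (X q) t))"
      by (rule continuous_on_compose2[OF cont continuous_on_UNIV_history[OF pX]]) simp
    then have "continuous_on UNIV (\<lambda>t. exp (- l * t) *\<^sub>R (W q t - D (history (X q) t)))"
      by (intro continuous_intros contW)
    from continuous_on_compose2[OF this, of UNIV "\<lambda>t. max t 0"] show ?thesis
      unfolding T_def by (simp add: continuous_on_max continuous_on_id)
  qed
  have "norm (T q t) \<le> norm q / 2 + M * norm \<phi>" for q t
  proof -
    let ?t = "max t 0"
    let ?A = "exp (- l * ?t) *\<^sub>R (W q ?t - D (history (W q) ?t))"
    let ?B = "exp (- l * ?t) *\<^sub>R D (history (apply_bu \<phi>) ?t)"
    have "T q t = ?A - ?B"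
      by (simp add: T_def DX algebra_simps)
    then have "norm (T q t) \<le> norm ?A + norm ?B"
      using norm_triangle_ineq4[of ?A ?B] by (rule ssubst)
    moreover have "norm ?B \<le> 1 * norm (D (history (apply_bu \<phi>) ?t))"
      unfolding norm_scaleR using l by (intro mult_right_mono) auto
    moreover have "norm (D (history (apply_bu \<phi>) ?t)) \<le> M * norm \<phi>"
      using M(2)[of "history (apply_bu \<phi>) ?t"] mult_left_mono[OF norm_history_apply_bu_le M(1)]
      by (rule order_trans)
    ultimately show ?thesis
      using estW[of ?t q] by linarith
  qed
  then have T_mem: "T q \<in> bcontfun" for q
    using contT by (intro bcontfun_normI) blast+
  have "\<exists>!q. Bcontfun (T q) = q"
  proof (rule banach_fix_type[of "1/2"]; (intro allI)?)
    fix p q :: "real \<Rightarrow>\<^sub>C (real ^ 'a)"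
    show "dist (Bcontfun (T p)) (Bcontfun (T q)) \<le> 1/2 * dist p q"
    proof (rule dist_bound)
      fix t :: real
      let ?t = "max t 0"
      have "W (p - q) = (\<lambda>t. W p t - W q t)"
        by (simp add: W_def fun_eq_iff algebra_simps)
      then have "W (p - q) ?t - D (history (W (p - q)) ?t) =
          (W p ?t - D (history (X p) ?t)) - (W q ?t - D (history (X q) ?t))"
        by (simp add: history_diff[OF pW pW] linear_diff[OF lin] DX)
      then have "dist (T p t) (T q t) = norm (exp (- l * ?t) *\<^sub>R (W (p - q) ?t - D (history (W (p - q)) ?t)))"
        by (simp only: dist_norm T_def scaleR_diff_right)
      then show "dist (apply_bcontfun (Bcontfun (T p)) t) (apply_bcontfun (Bcontfun (T q)) t) \<le> 1/2 * dist p q"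
        using estW[of ?t "p - q"] by (simp add: Bcontfun_inverse[OF T_mem] dist_norm)
    qed
  qed simp_all
  then obtain q where "Bcontfun (T q) = q" by blast
  then have q: "apply_bcontfun q t = T q t" for t
    using Bcontfun_inverse[OF T_mem, of q] by simp
  have "history (apply_bu \<phi>) 0 = \<phi>" by (rule history_apply_bu_0)
  moreover have "history (X q) 0 = history (apply_bu \<phi>) 0"
    by (rule history_cong) (simp add: X\<phi>)
  ultimately have q0: "apply_bcontfun q 0 = 0"
    by (simp add: q T_def W0 \<phi>)
  show thesis
  proof (rule that[of "X q"])
    fix t :: real assume t: "0 \<le> t"
    have "W q t = exp (l * t) *\<^sub>R apply_bcontfun q t"
      using t q0 by (simp add: W_def)
    also have "\<dots> = W q t - D (history (X q) t)"
      using t by (subst q) (simp add: T_def exp_minus)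
    finally show "D (history (X q) t) = 0" by simp
  qed (use contX X\<phi> in auto)
qed

text \<open>
  Let \<open>B\<close> be the maximum of \<open>exp (- l * t) * norm (w t)\<close>. At a maximum point the weighted atomicity bounds
  \<open>B\<close> by \<open>B / 2\<close> plus the contribution of \<open>D w\<^sub>t\<close>. The latter may itself depend on \<open>B\<close>: a further
  \<open>B / 4\<close> can be absorbed, which leaves \<open>B / 4 \<le> c\<close>.
\<close>

lemma neutral_gronwall:
  assumes D: "exp_atomic l (1/2) D"
    and w: "bu_path T w" "\<And>s. s \<le> 0 \<Longrightarrow> w s = 0" and T: "0 \<le> T"
    and step: "\<And>B t. 0 \<le> t \<Longrightarrow> t \<le> T \<Longrightarrow> (\<And>s. s \<le> T \<Longrightarrow> norm (w s) \<le> B * exp (l * s)) \<Longrightarrow>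
      norm (D (history w t)) \<le> (c + B / 4) * exp (l * t)"
    and t: "t \<le> T"
  shows "norm (w t) \<le> 4 * c * exp (l * t)"
proof -
  let ?f = "\<lambda>t. exp (- l * t) * norm (w t)"
  have "continuous_on {0..T} w"
    by (rule continuous_on_subset[OF bu_path_imp_continuous[OF w(1)]]) auto
  then have "continuous_on {0..T} ?f"
    by (intro continuous_intros)
  then obtain t0 where t0: "0 \<le> t0" "t0 \<le> T" "\<And>t. 0 \<le> t \<Longrightarrow> t \<le> T \<Longrightarrow> ?f t \<le> ?f t0"
    using continuous_attains_sup[of "{0..T}" ?f] T by auto
  define B where "B = ?f t0"
  have B: "norm (w s) \<le> B * exp (l * s)" if "s \<le> T" for s
  proof (cases "s \<le> 0")
    case True
    then show ?thesis by (simp add: w(2) B_def)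
  next
    case False
    then have "?f s \<le> B" using t0(3)[of s] that by (simp add: B_def)
    then show ?thesis by (simp add: exp_minus field_simps)
  qed
  have "bu_path t0 w"
    using bu_path_mono[OF w(1)] t0(2) by simp
  then have "norm (w t0 - D (history w t0)) \<le> 1/2 * B * exp (l * t0)"
    by (rule weighted_atomic_estimate[OF D]) (use B t0(2) in auto)
  moreover have "norm (D (history w t0)) \<le> (c + B / 4) * exp (l * t0)"
    using t0(1,2) B by (rule step)
  moreover have "norm (w t0) = B * exp (l * t0)"
    by (simp add: B_def exp_minus)
  ultimately have "B * exp (l * t0) \<le> (c + B / 4 + 1/2 * B) * exp (l * t0)"
    using norm_triangle_ineq2[of "w t0" "D (history w t0)"] by (simp add: distrib_right)
  then have "B \<le> 4 * c" by simp
  then have "B * exp (l * t) \<le> 4 * c * exp (l * t)" by simp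
  with B[OF t] show ?thesis by linarith
qed

text \<open>
  Subtracting from \<open>e\<close> its initial segment, continued as a constant, leaves a path that vanishes on
  \<open>{..0}\<close>; its image under \<open>D\<close> changes by at most the norm of \<open>D\<close> times the norm of the segment.
\<close>

lemma nonhomogeneous_estimate:
  assumes D1: "cond_D1 D" and D3: "cond_D3 D" and T: "0 \<le> T"
  obtains C where "0 \<le> C"
    "\<And>e b. bu_path T e \<Longrightarrow> (\<And>t. 0 \<le> t \<Longrightarrow> t \<le> T \<Longrightarrow> norm (D (history e t)) \<le> b) \<Longrightarrow>
      infnorm (e T) \<le> C * (b + norm (history e 0))"
proof -
  have lin: "linear D" using D1 by (simp add: cond_D1_def)
  obtain M where M: "0 \<le> M" "\<And>x. norm (D x) \<le> M * norm x"
    using cond_D1_bound[OF D1] by blast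
  obtain l where l: "0 < l" and atomic: "exp_atomic l (1/2) D"
    using atomic_imp_exp_atomic[OF D3, of "1/2"] by (metis order_refl zero_less_divide_1_iff zero_less_numeral)
  show thesis
  proof (rule that[of "1 + 4 * (1 + M) * exp (l * T)"])
    fix e b assume e: "bu_path T e" and b: "\<And>t. 0 \<le> t \<Longrightarrow> t \<le> T \<Longrightarrow> norm (D (history e t)) \<le> b"
    define \<psi> where "\<psi> = history e 0"
    have b0: "0 \<le> b" using order_trans[OF norm_ge_zero b[OF order_refl T]] .
    let ?w = "\<lambda>t. e t - apply_bu \<psi> t"
    have e0: "bu_path 0 e" using bu_path_mono[OF e T] .
    have w: "bu_path T ?w" by (intro bu_path_diff e bu_path_apply_bu)
    have "norm (?w T) \<le> 4 * (b + M * norm \<psi>) * exp (l * T)"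
    proof (rule neutral_gronwall[OF atomic w _ T _ order_refl])
      show "?w s = 0" if "s \<le> 0" for s
        using that by (simp add: \<psi>_def apply_history_path[OF e0])
      fix B t assume t: "0 \<le> t" "t \<le> T" and B: "\<And>s. s \<le> T \<Longrightarrow> norm (?w s) \<le> B * exp (l * s)"
      have "0 \<le> B" using order_trans[OF norm_ge_zero B[OF T]] by simp
      have "history ?w t = history e t - history (apply_bu \<psi>) t"
        by (intro history_diff bu_path_apply_bu bu_path_mono[OF e t(2)])
      then have "norm (D (history ?w t)) \<le> norm (D (history e t)) + norm (D (history (apply_bu \<psi>) t))"
        by (simp add: linear_diff[OF lin] norm_triangle_ineq4)
      also have "\<dots> \<le> b + M * norm \<psi>"
        using b[OF t] M(2)[of "history (apply_bu \<psi>) t"]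
          mult_left_mono[OF norm_history_apply_bu_le[of \<psi> t] M(1)] by linarith
      also have "\<dots> \<le> (b + M * norm \<psi> + B / 4) * 1"
        using \<open>0 \<le> B\<close> by simp
      also have "\<dots> \<le> (b + M * norm \<psi> + B / 4) * exp (l * t)"
        using \<open>0 \<le> B\<close> b0 M(1) l t by (intro mult_left_mono) auto
      finally show "norm (D (history ?w t)) \<le> (b + M * norm \<psi> + B / 4) * exp (l * t)" .
    qed
    then have "infnorm (?w T) \<le> 4 * (b + M * norm \<psi>) * exp (l * T)"
      using infnorm_le_norm order_trans by blast
    also have "\<dots> \<le> 4 * ((1 + M) * (b + norm \<psi>)) * exp (l * T)"
      using b0 M(1) by (intro mult_right_mono mult_left_mono) (auto simp: algebra_simps)
    finally have "infnorm (?w T) \<le> 4 * ((1 + M) * (b + norm \<psi>)) * exp (l * T)" .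
    moreover have "infnorm (e T) \<le> infnorm (?w T) + infnorm (apply_bu \<psi> T)"
      using infnorm_triangle[of "?w T" "apply_bu \<psi> T"] by simp
    moreover have "infnorm (apply_bu \<psi> T) \<le> norm \<psi>"
      using infnorm_le_norm_bu[of 0 \<psi>] T by (subst apply_bu_min) simp
    ultimately show "infnorm (e T) \<le> (1 + 4 * (1 + M) * exp (l * T)) * (b + norm (history e 0))"
      using b0 unfolding \<psi>_def[symmetric] by (simp add: algebra_simps)
  qed (use M in simp)
qed

section \<open>Stability estimates for \<open>D\<close>\<close>

text \<open>
  The profile \<open>E a\<close> given by \<open>s \<mapsto> max 0 (1 + l * s) *\<^sub>R a\<close> is dominated by \<open>exp (l * s) * norm a\<close> and has
  the value \<open>a\<close> at \<open>0\<close>, so \<open>D (E a)\<close> differs from \<open>a\<close> by at most \<open>norm a / 2\<close>. Hence the linear map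
  \<open>a \<mapsto> D (E a)\<close> is injective, by finite dimension surjective, and its inverse has norm at most \<open>2\<close>.
\<close>

lemma bounded_right_inverse:
  assumes D1: "cond_D1 D" and D3: "cond_D3 D"
  obtains \<psi> where "D \<psi> = y" "norm \<psi> \<le> 2 * norm y"
proof -
  have lin: "linear D" using D1 by (simp add: cond_D1_def)
  obtain l where l: "0 < l" and atomic: "exp_atomic l (1/2) D"
    using atomic_imp_exp_atomic[OF D3, of "1/2"] by (metis order_refl zero_less_divide_1_iff zero_less_numeral)
  \<comment> \<open>Written as a history segment of \<open>t \<mapsto> max 0 (l * t) *\<^sub>R a\<close>, which starts from the zero segment,
    the profile is bounded and uniformly continuous by construction.\<close>
  define E where "E a = history (\<lambda>t. max 0 (l * t) *\<^sub>R a) (1 / l)" for a :: "real ^ 'a"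
  have E: "apply_bu (E a) s = max 0 (1 + l * min s 0) *\<^sub>R a" for a s
  proof -
    have "bu_path (1 / l) (\<lambda>t. max 0 (l * t) *\<^sub>R a)"
    proof (rule bu_path_extension)
      show "continuous_on {..1 / l} (\<lambda>t. max 0 (l * t) *\<^sub>R a)"
        by (intro continuous_intros)
      show "max 0 (l * s) *\<^sub>R a = apply_bu 0 s" if "s \<le> 0" for s
        using that l mult_nonneg_nonpos[of l s] by (simp add: zero_bu.rep_eq max_absorb1)
    qed
    then show ?thesis
      using l by (simp add: E_def apply_history_path distrib_left)
  qed
  have near: "norm (a - D (E a)) \<le> 1/2 * norm a" for a
  proof -
    have "norm (apply_bu (E a) s) \<le> norm a * exp (l * s)" if "s \<le> 0" for s
    proof -
      have "max 0 (1 + l * s) \<le> exp (l * s)"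
        using exp_ge_add_one_self[of "l * s"] by simp
      then show ?thesis
        using that by (simp add: E mult.commute mult_left_mono)
    qed
    then have "norm (apply_bu (E a) 0 - D (E a)) \<le> 1/2 * norm a"
      using atomic unfolding exp_atomic_def by blast
    then show ?thesis by (simp add: E)
  qed
  have "linear (\<lambda>a. D (E a))"
  proof (rule linearI)
    fix a b :: "real ^ 'a" and r :: real
    have "E (a + b) = E a + E b"
      by (rule bu_eqI) (simp add: E plus_bu.rep_eq scaleR_add_right)
    then show "D (E (a + b)) = D (E a) + D (E b)"
      by (simp add: linear_add[OF lin])
    have "E (r *\<^sub>R a) = r *\<^sub>R E a"
      by (rule bu_eqI) (simp add: E scaleR_bu.rep_eq)
    then show "D (E (r *\<^sub>R a)) = r *\<^sub>R D (E a)"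
      by (simp add: linear_scale[OF lin])
  qed
  moreover from this have "inj (\<lambda>a. D (E a))"
  proof (subst linear_injective_0, assumption, intro allI impI)
    fix a assume "D (E a) = 0"
    then show "a = 0" using near[of a] by simp
  qed
  ultimately have "surj (\<lambda>a. D (E a))"
    by (rule linear_inj_imp_surj)
  then obtain a where a: "D (E a) = y" by (metis surjD)
  have "norm a \<le> 2 * norm y"
    using near[of a] norm_triangle_ineq2[of a y] by (simp add: a)
  moreover have "norm (E a) \<le> norm a"
  proof (rule norm_bu_le)
    fix s :: real assume "s \<le> 0"
    then have "max 0 (1 + l * s) \<le> 1" using l by (simp add: mult_le_0_iff)
    then have "max 0 (1 + l * s) * infnorm a \<le> 1 * norm a"
      by (intro mult_mono infnorm_le_norm infnorm_pos_le) auto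
    then show "infnorm (apply_bu (E a) s) \<le> norm a"
      using \<open>s \<le> 0\<close> by (simp add: E infnorm_mul)
  qed
  ultimately show thesis using a by (intro that[of "E a"]) auto
qed

text \<open>
  Run the homogeneous equation for a time \<open>\<tau>\<close> with \<open>c \<tau> < \<eta>\<close>, starting from the segment of \<open>v\<close> at time
  \<open>-\<tau>\<close>, corrected by a segment of norm at most \<open>2 * b\<close> so that \<open>D\<close> vanishes on it. By stability the
  solution has size at most \<open>\<eta> * (norm v + 2 * b)\<close> at the end. Its difference from \<open>v\<close> starts with
  norm at most \<open>2 * b\<close> and has an image under \<open>D\<close> of size \<open>b\<close>, so it is \<open>O(b)\<close> at the end.

  The hypothesis concerns only the window \<open>{-\<tau>..0}\<close>, and this is what turns locally uniform
  convergence of \<open>D v\<^sub>r\<close> into locally uniform convergence of \<open>v\<close>.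
\<close>

lemma stable_local_estimate:
  assumes D1: "cond_D1 D" and D3: "cond_D3 D" and D4: "cond_D4 D" and \<eta>: "0 < \<eta>"
  obtains \<tau> K where "0 \<le> \<tau>" "0 \<le> K"
    "\<And>v b. (\<And>r. - \<tau> \<le> r \<Longrightarrow> r \<le> 0 \<Longrightarrow> norm (D (history (apply_bu v) r)) \<le> b) \<Longrightarrow>
      infnorm (apply_bu v 0) \<le> \<eta> * norm v + K * b"
proof -
  have lin: "linear D" using D1 by (simp add: cond_D1_def)
  obtain c where c: "(c \<longlongrightarrow> 0) at_top"
    and stable: "\<And>\<phi> x t. D \<phi> = 0 \<Longrightarrow> continuous_on UNIV x \<Longrightarrow> (\<forall>s\<le>0. x s = apply_bu \<phi> s) \<Longrightarrow>
        (\<forall>t\<ge>0. D (history x t) = 0) \<Longrightarrow> 0 \<le> t \<Longrightarrow> infnorm (x t) \<le> c t * norm \<phi>"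
    using D4 unfolding cond_D4_def by blast
  have "eventually (\<lambda>t. c t < \<eta> \<and> 0 \<le> t) at_top"
    by (intro eventually_conj order_tendstoD(2)[OF c \<eta>] eventually_ge_at_top)
  then obtain \<tau> where \<tau>: "c \<tau> < \<eta>" "0 \<le> \<tau>"
    by (auto simp: eventually_at_top_linorder)
  obtain C where C: "0 \<le> C"
    "\<And>e b. bu_path \<tau> e \<Longrightarrow> (\<And>t. 0 \<le> t \<Longrightarrow> t \<le> \<tau> \<Longrightarrow> norm (D (history e t)) \<le> b) \<Longrightarrow>
      infnorm (e \<tau>) \<le> C * (b + norm (history e 0))"
    using nonhomogeneous_estimate[OF D1 D3 \<tau>(2)] by blast
  show thesis
  proof (rule that[of \<tau> "2 * \<eta> + 3 * C"])
    fix v b assume b: "\<And>r. - \<tau> \<le> r \<Longrightarrow> r \<le> 0 \<Longrightarrow> norm (D (history (apply_bu v) r)) \<le> b"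
    define \<phi> where "\<phi> = history (apply_bu v) (- \<tau>)"
    obtain \<psi> where \<psi>: "D \<psi> = D \<phi>" "norm \<psi> \<le> 2 * norm (D \<phi>)"
      using bounded_right_inverse[OF D1 D3] by blast
    have \<psi>b: "norm \<psi> \<le> 2 * b"
      using \<psi>(2) b[of "- \<tau>"] \<tau>(2) by (simp add: \<phi>_def)
    have D0: "D (\<phi> - \<psi>) = 0" by (simp add: linear_diff[OF lin] \<psi>)
    obtain x where x: "continuous_on UNIV x" "\<And>s. s \<le> 0 \<Longrightarrow> x s = apply_bu (\<phi> - \<psi>) s"
      "\<And>t. 0 \<le> t \<Longrightarrow> D (history x t) = 0"
      using homogeneous_solution_exists[OF D1 D3 D0] by blast
    have px: "bu_path t x" for t
      using x(1,2) by (intro bu_path_extension) (auto intro: continuous_on_subset)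
    let ?v = "\<lambda>t. apply_bu v (t - \<tau>)"
    have pv: "bu_path t ?v" for t
      using bu_path_shift[of t "- \<tau>", OF bu_path_apply_bu] by simp
    have hv: "history ?v t = history (apply_bu v) (t - \<tau>)" for t
      by (rule bu_eqI) (simp add: apply_history_path pv bu_path_apply_bu algebra_simps)
    let ?e = "\<lambda>t. ?v t - x t"
    have he: "history ?e t = history (apply_bu v) (t - \<tau>) - history x t" for t
      by (simp add: history_diff pv px hv)
    have "history x 0 = \<phi> - \<psi>"
      by (rule bu_eqI) (simp add: apply_history_path px x(2))
    then have "history ?e 0 = \<psi>"
      by (simp add: he \<phi>_def)
    moreover have "infnorm (?e \<tau>) \<le> C * (b + norm (history ?e 0))"
    proof (rule C(2))
      show "bu_path \<tau> ?e" by (intro bu_path_diff pv px)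
      show "norm (D (history ?e t)) \<le> b" if "0 \<le> t" "t \<le> \<tau>" for t
        using b[of "t - \<tau>"] that by (simp add: he linear_diff[OF lin] x(3))
    qed
    ultimately have "infnorm (?e \<tau>) \<le> C * (3 * b)"
      using \<psi>b mult_left_mono[OF _ C(1), of "b + norm \<psi>" "3 * b"] by simp
    moreover have "infnorm (x \<tau>) \<le> \<eta> * (norm v + 2 * b)"
    proof -
      have "infnorm (x \<tau>) \<le> c \<tau> * norm (\<phi> - \<psi>)"
        using x D0 \<tau>(2) by (intro stable) auto
      also have "\<dots> \<le> \<eta> * norm (\<phi> - \<psi>)"
        using \<tau>(1) by (intro mult_right_mono) auto
      also have "norm (\<phi> - \<psi>) \<le> norm v + 2 * b"
        using norm_triangle_ineq4[of \<phi> \<psi>] norm_history_apply_bu_le[of v "- \<tau>"] \<psi>b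
        unfolding \<phi>_def by linarith
      finally show ?thesis using \<eta> by simp
    qed
    moreover have "infnorm (apply_bu v 0) \<le> infnorm (?e \<tau>) + infnorm (x \<tau>)"
      using infnorm_triangle[of "?e \<tau>" "x \<tau>"] by simp
    ultimately show "infnorm (apply_bu v 0) \<le> \<eta> * norm v + (2 * \<eta> + 3 * C) * b"
      by (simp add: algebra_simps)
  qed (use \<tau> \<eta> C in auto)
qed

text \<open>
  With \<open>\<eta> = 1/2\<close> the local estimate holds at every time \<open>s \<le> 0\<close>, and the supremum over \<open>s\<close> absorbs
  \<open>norm v / 2\<close>. In particular a function in the phase space is determined by \<open>r \<mapsto> D v\<^sub>r\<close>.
\<close>

lemma stable_global_estimate:
  assumes D1: "cond_D1 D" and D3: "cond_D3 D" and D4: "cond_D4 D"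
  obtains C where "\<And>v b. (\<And>r. r \<le> 0 \<Longrightarrow> norm (D (history (apply_bu v) r)) \<le> b) \<Longrightarrow> norm v \<le> C * b"
proof -
  obtain K \<tau> where K: "\<And>v b. (\<And>r. - \<tau> \<le> r \<Longrightarrow> r \<le> 0 \<Longrightarrow> norm (D (history (apply_bu v) r)) \<le> b) \<Longrightarrow>
      infnorm (apply_bu v 0) \<le> 1/2 * norm v + K * b"
    using stable_local_estimate[OF D1 D3 D4, of "1/2"] by (metis half_gt_zero zero_less_one)
  show thesis
  proof (rule that[of "2 * K"])
    fix v b assume b: "\<And>r. r \<le> 0 \<Longrightarrow> norm (D (history (apply_bu v) r)) \<le> b"
    have "norm v \<le> 1/2 * norm v + K * b"
    proof (rule norm_bu_le)
      fix s :: real assume s: "s \<le> 0"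
      have "infnorm (apply_bu (history (apply_bu v) s) 0) \<le> 1/2 * norm (history (apply_bu v) s) + K * b"
        by (rule K) (use b s in \<open>simp add: history_history bu_path_apply_bu\<close>)
      then show "infnorm (apply_bu v s) \<le> 1/2 * norm v + K * b"
        using norm_history_apply_bu_le[of v s] s by (simp add: apply_history_path bu_path_apply_bu)
    qed
    then show "norm v \<le> 2 * K * b" by simp
  qed
qed

section \<open>Solutions of the neutral equation\<close>

lemma nfde_solution_bu_path: "nfde_solution D F \<sigma> \<omega> x T z \<Longrightarrow> t \<le> T \<Longrightarrow> bu_path t z"
  unfolding nfde_solution_def by (metis bu_path_mono bu_path_extension)

lemma nfde_solution_restrict:
  assumes "nfde_solution D F \<sigma> \<omega> x T z" "t \<le> T"
  shows "nfde_solution D F \<sigma> \<omega> x t z"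
  unfolding nfde_solution_def
proof (intro conjI ballI)
  have "continuous_on {..T} z" using assms(1) by (simp add: nfde_solution_def)
  then show "continuous_on {..t} z"
    by (rule continuous_on_subset) (use assms(2) in simp)
  show "\<forall>s\<le>0. z s = apply_bu x s" using assms(1) by (simp add: nfde_solution_def)
  fix r assume r: "r \<in> {0..t}"
  then have "((\<lambda>t. D (history z t)) has_vector_derivative F (\<sigma> r \<omega>) (history z r)) (at r within {0..T})"
    using assms by (simp add: nfde_solution_def)
  then show "((\<lambda>t. D (history z t)) has_vector_derivative F (\<sigma> r \<omega>) (history z r)) (at r within {0..t})"
    by (rule has_vector_derivative_within_subset) (use assms(2) in auto)
qed

lemma nfde_solution_cong:
  assumes z: "nfde_solution D F \<sigma> \<omega> x T z" and eq: "\<And>t. t \<le> T \<Longrightarrow> y t = z t" and T: "0 \<le> T"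
  shows "nfde_solution D F \<sigma> \<omega> x T y"
  unfolding nfde_solution_def
proof (intro conjI ballI)
  have "continuous_on {..T} z" using z by (simp add: nfde_solution_def)
  then show "continuous_on {..T} y"
    by (rule continuous_on_eq) (simp add: eq)
  show "\<forall>s\<le>0. y s = apply_bu x s"
    using z T by (simp add: nfde_solution_def eq)
  fix r assume r: "r \<in> {0..T}"
  have h: "history y t = history z t" if "t \<in> {0..T}" for t
    using that by (intro history_cong eq) simp
  have "((\<lambda>t. D (history z t)) has_vector_derivative F (\<sigma> r \<omega>) (history z r)) (at r within {0..T})"
    using z r by (simp add: nfde_solution_def)
  then show "((\<lambda>t. D (history y t)) has_vector_derivative F (\<sigma> r \<omega>) (history y r)) (at r within {0..T})"
    unfolding h[OF r] by (rule has_vector_derivative_transform[OF r, rotated]) (simp add: h)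
qed

text \<open>
  Both orbits stay in a compact subset of the phase space on \<open>{0..T}\<close>, where \<open>F\<close> has a Lipschitz constant
  \<open>L\<close>. Integrating, a bound \<open>B * exp (l * s)\<close> on the difference of the solutions gives the bound
  \<open>(L * B / l) * exp (l * t)\<close> for its image under \<open>D\<close>, and this is absorbed if \<open>l \<ge> 4 * L\<close>.
\<close>

lemma nfde_solution_unique:
  assumes D1: "cond_D1 D" and D3: "cond_D3 D" and F: "cond_F1 \<Omega> F"
    and flow: "continuous_flow \<Omega> \<sigma>" and \<Omega>: "compact \<Omega>" "\<omega> \<in> \<Omega>"
    and sol: "nfde_solution D F \<sigma> \<omega> x T y" "nfde_solution D F \<sigma> \<omega> x T z" and T: "0 \<le> T" and t: "t \<le> T"
  shows "y t = z t"
proof -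
  have lin: "linear D" using D1 by (simp add: cond_D1_def)
  note py = nfde_solution_bu_path[OF sol(1)] and pz = nfde_solution_bu_path[OF sol(2)]
  have sub: "{0..T} \<subseteq> {..T}" by auto
  let ?X = "history y ` {0..T} \<union> history z ` {0..T}"
  have "compact ?X"
    by (intro compact_Un compact_continuous_image compact_Icc continuous_on_subset[OF _ sub]
        continuous_on_history py pz order_refl)
  moreover have "continuous_on \<Omega> (\<lambda>\<omega>. F \<omega> x)" for x
  proof -
    have "continuous_on \<Omega> (\<lambda>\<omega>. case (\<omega>, x) of (\<omega>, x) \<Rightarrow> F \<omega> x)"
    proof (rule continuous_on_compose2[where g = "\<lambda>(\<omega>, x). F \<omega> x"])
      show "continuous_on (\<Omega> \<times> UNIV) (\<lambda>(\<omega>, x). F \<omega> x)" using F by (simp add: cond_F1_def)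
    qed (auto intro!: continuous_intros)
    then show ?thesis by simp
  qed
  moreover have "local_lipschitz \<Omega> ?X F"
    using F unfolding cond_F1_def by (blast intro: local_lipschitz_subset)
  ultimately obtain L where L: "\<And>\<omega>. \<omega> \<in> \<Omega> \<Longrightarrow> L-lipschitz_on ?X (F \<omega>)"
    using local_lipschitz_compact_implies_lipschitz[OF _ _ \<Omega>(1)] by metis
  have L0: "0 \<le> L" using lipschitz_on_nonneg[OF L[OF \<Omega>(2)]] .
  obtain l0 where l0: "0 < l0" "\<And>l. l0 \<le> l \<Longrightarrow> exp_atomic l (1/2) D"
    using atomic_imp_exp_atomic[OF D3, of "1/2"] by auto
  define l where "l = l0 + 4 * L"
  have l: "0 < l" "4 * L \<le> l" and atomic: "exp_atomic l (1/2) D"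
    using l0 L0 by (auto simp: l_def)
  let ?w = "\<lambda>t. y t - z t"
  have hw: "history ?w r = history y r - history z r" if "r \<le> T" for r
    by (rule history_diff[OF py[OF that] pz[OF that]])
  have w0: "?w s = 0" if "s \<le> 0" for s
    using sol that by (simp add: nfde_solution_def)
  let ?G = "\<lambda>r. D (history y r) - D (history z r)"
  let ?G' = "\<lambda>r. F (\<sigma> r \<omega>) (history y r) - F (\<sigma> r \<omega>) (history z r)"
  have G': "(?G has_vector_derivative ?G' r) (at r within {0..T})" if "r \<in> {0..T}" for r
    using sol that by (intro has_vector_derivative_diff) (simp_all add: nfde_solution_def)
  have "norm (?w t) \<le> 4 * 0 * exp (l * t)"
  proof (rule neutral_gronwall[OF atomic _ w0 T _ t])
    show "bu_path T ?w" by (intro bu_path_diff py pz order_refl)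
    fix B t assume t: "0 \<le> t" "t \<le> T" and B: "\<And>s. s \<le> T \<Longrightarrow> norm (?w s) \<le> B * exp (l * s)"
    have B0: "0 \<le> B" using order_trans[OF norm_ge_zero B[OF T]] by simp
    have G0: "?G 0 = 0"
    proof -
      have "history y 0 = history z 0"
        using w0 by (intro history_cong) simp
      then show ?thesis by simp
    qed
    let ?\<phi> = "\<lambda>r. L * B / l * exp (l * r)"
    have "norm (?G t) \<le> ?\<phi> t"
    proof (cases "t = 0")
      case True
      then show ?thesis using G0 L0 B0 l by simp
    next
      case False
      have "norm (?G t - ?G 0) \<le> ?\<phi> t - ?\<phi> 0"
      proof (rule differentiable_bound_general)
        show "0 < t" using False t by simp
        show "continuous_on {0..t} ?G"
          unfolding continuous_on_eq_continuous_within
        proof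
          fix r assume "r \<in> {0..t}"
          then have "continuous (at r within {0..T}) ?G"
            using t by (intro has_vector_derivative_continuous[OF G']) simp
          then show "continuous (at r within {0..t}) ?G"
            by (rule continuous_within_subset) (use t in auto)
        qed
        show "continuous_on {0..t} ?\<phi>" by (intro continuous_intros)
        fix r assume r: "0 < r" "r < t"
        then show "(?G has_vector_derivative ?G' r) (at r)"
          using G'[of r] t at_within_Icc_at[of 0 r T] by simp
        show "(?\<phi> has_vector_derivative L * B * exp (l * r)) (at r)"
          using l by (auto intro!: derivative_eq_intros simp: has_real_derivative_iff_has_vector_derivative[symmetric])
        have "norm (?G' r) \<le> L * dist (history y r) (history z r)"
        proof -
          have "\<sigma> r \<omega> \<in> \<Omega>" using flow \<Omega>(2) by (simp add: continuous_flow_def)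
          from lipschitz_onD[OF L[OF this], of "history y r" "history z r"] show ?thesis
            using r t by (simp add: dist_norm)
        qed
        also have "dist (history y r) (history z r) = norm (history ?w r)"
          using r t by (simp add: dist_norm hw)
        also have "norm (history ?w r) \<le> B * exp (l * r)"
        proof (rule norm_history_le)
          show "bu_path r ?w"
            using r t by (intro bu_path_diff py pz) auto
          fix s assume s: "s \<le> r"
          have "infnorm (?w s) \<le> norm (?w s)" by (rule infnorm_le_norm)
          also have "\<dots> \<le> B * exp (l * s)" using s r t by (intro B) simp
          also have "\<dots> \<le> B * exp (l * r)" using s l B0 by (intro mult_left_mono) auto
          finally show "infnorm (?w s) \<le> B * exp (l * r)" .
        qed
        finally show "norm (?G' r) \<le> L * B * exp (l * r)"
          using L0 by (simp add: mult_left_mono mult.assoc)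
      qed
      moreover have "0 \<le> ?\<phi> 0" using L0 B0 l by simp
      ultimately show ?thesis unfolding G0 by simp
    qed
    also have "L * B / l \<le> B / 4"
      using l B0 mult_right_mono[OF l(2) B0] by (simp add: field_simps)
    finally show "norm (D (history ?w t)) \<le> (0 + B / 4) * exp (l * t)"
      using t by (simp add: hw linear_diff[OF lin])
  qed
  then show ?thesis by simp
qed

text \<open>
  \<^const>\<open>nfde_z\<close> chooses a solution separately for each time; by uniqueness the choices fit together.
\<close>

lemma nfde_solution_nfde_z:
  assumes D1: "cond_D1 D" and D3: "cond_D3 D" and F: "cond_F1 \<Omega> F"
    and flow: "continuous_flow \<Omega> \<sigma>" and \<Omega>: "compact \<Omega>" "\<omega> \<in> \<Omega>"
    and T: "T \<in> nfde_time D F \<sigma> \<omega> x"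
  shows "nfde_solution D F \<sigma> \<omega> x T (\<lambda>t. nfde_z D F \<sigma> t \<omega> x)"
proof -
  obtain z where T0: "0 \<le> T" and z: "nfde_solution D F \<sigma> \<omega> x T z"
    using T by (auto simp: nfde_time_def)
  show ?thesis
  proof (rule nfde_solution_cong[OF z _ T0])
    fix t assume t: "t \<le> T"
    show "nfde_z D F \<sigma> t \<omega> x = z t"
    proof (cases "t \<le> 0")
      case True
      then show ?thesis using z by (simp add: nfde_z_def nfde_solution_def)
    next
      case False
      have zt: "nfde_solution D F \<sigma> \<omega> x t z" by (rule nfde_solution_restrict[OF z t])
      then have "nfde_solution D F \<sigma> \<omega> x t (SOME z. nfde_solution D F \<sigma> \<omega> x t z)"
        by (rule someI[of "nfde_solution D F \<sigma> \<omega> x t"])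
      then have "(SOME z. nfde_solution D F \<sigma> \<omega> x t z) t = z t"
        using nfde_solution_unique[OF D1 D3 F flow \<Omega> _ zt, of _ t] False by simp
      then show ?thesis using False by (simp add: nfde_z_def)
    qed
  qed
qed

text \<open>
  The forward solution starting at \<open>\<psi> s\<close> reaches \<open>(\<omega>, x)\<close> at time \<open>-s\<close>. Hence it is a translate of \<open>x\<close>
  itself, and \<open>x\<close> satisfies the equation on \<open>{s..0}\<close>.
\<close>

lemma backward_orbit_history:
  assumes D1: "cond_D1 D" and D3: "cond_D3 D" and F: "cond_F1 \<Omega> F"
    and flow: "continuous_flow \<Omega> \<sigma>" and \<Omega>: "compact \<Omega>"
    and \<psi>: "backward_orbit_extension D F \<Omega> \<sigma> \<omega> x \<psi>" and s: "s \<le> 0"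
  shows "snd (\<psi> s) = history (apply_bu x) s"
    and "r \<in> {s..0} \<Longrightarrow> ((\<lambda>t. D (history (apply_bu x) t)) has_vector_derivative
      F (\<sigma> r \<omega>) (history (apply_bu x) r)) (at r within {s..0})"
proof -
  let ?z = "\<lambda>t. nfde_z D F \<sigma> t (fst (\<psi> s)) (snd (\<psi> s))"
  have mem: "fst (\<psi> s) \<in> \<Omega>"
    using \<psi> s unfolding backward_orbit_extension_def by (metis atMost_iff imageI mem_Times_iff subsetD)
  have time: "- s \<in> nfde_time D F \<sigma> (fst (\<psi> s)) (snd (\<psi> s))"
    and "nfde_tau D F \<sigma> (- s) (\<psi> s) = (\<omega>, x)"
    using \<psi> s by (auto simp: backward_orbit_extension_def)
  then have \<omega>: "\<sigma> (- s) (fst (\<psi> s)) = \<omega>" and x: "history ?z (- s) = x"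
    by (simp_all add: nfde_tau_def case_prod_beta nfde_u_def)
  note sol = nfde_solution_nfde_z[OF D1 D3 F flow \<Omega> mem time]
  have z: "?z t = apply_bu x (t + s)" if "t \<le> - s" for t
    using apply_history_path[OF nfde_solution_bu_path[OF sol order_refl], of "t + s"] that
    by (simp add: x)
  have hz: "history ?z t = history (apply_bu x) (t + s)" if "t \<le> - s" for t
  proof (rule bu_eqI)
    fix r :: real assume "r \<le> 0"
    then show "apply_bu (history ?z t) r = apply_bu (history (apply_bu x) (t + s)) r"
      using that z[of "t + r"] nfde_solution_bu_path[OF sol that]
      by (simp add: apply_history_path bu_path_apply_bu algebra_simps)
  qed
  have "snd (\<psi> s) = history ?z 0"
    using nfde_solution_bu_path[OF sol, of 0] s
    by (intro bu_eqI) (simp add: apply_history_path nfde_z_def)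
  then show "snd (\<psi> s) = history (apply_bu x) s"
    using hz[of 0] s by simp
  assume r: "r \<in> {s..0}"
  have "\<sigma> (r - s) (fst (\<psi> s)) = \<sigma> r \<omega>"
    using flow mem unfolding \<omega>[symmetric] continuous_flow_def by (metis uminus_add_conv_diff add.commute)
  then have "((\<lambda>t. D (history ?z t)) has_vector_derivative
      F (\<sigma> r \<omega>) (history (apply_bu x) r)) (at (r - s) within {0..- s})"
    using sol r hz[of "r - s"] unfolding nfde_solution_def by (metis (no_types, lifting)
      atLeastAtMost_iff diff_add_cancel diff_ge_0_iff_ge diff_mono diff_0 order_refl)
  moreover have "(\<lambda>t. t - s) ` {s..0} = {0..- s}"
    by (simp add: image_diff_atLeastAtMost)
  ultimately have "((\<lambda>t. D (history ?z t)) \<circ> (\<lambda>t. t - s) has_vector_derivative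
      1 *\<^sub>R F (\<sigma> r \<omega>) (history (apply_bu x) r)) (at r within {s..0})"
    by (intro vector_diff_chain_within) (auto intro!: derivative_eq_intros)
  then show "((\<lambda>t. D (history (apply_bu x) t)) has_vector_derivative
      F (\<sigma> r \<omega>) (history (apply_bu x) r)) (at r within {s..0})"
    unfolding scaleR_one by (rule has_vector_derivative_transform[OF r, rotated]) (simp add: hz)
qed

lemma has_vector_derivative_at_joint:
  assumes "(f has_vector_derivative f') (at x within {a..x})" "(f has_vector_derivative f') (at x within {x..b})"
    and "a < x" "x < b"
  shows "(f has_vector_derivative f') (at x)"
proof -
  have "(f has_vector_derivative f') (at x within ({a..x} \<union> {x..b}))"
    using assms(1,2) unfolding has_vector_derivative_def has_derivative_within
    by (auto intro: Lim_Un)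
  moreover have "{a..x} \<union> {x..b} = {a..b}" using assms(3,4) by auto
  ultimately show ?thesis using assms(3,4) by (simp add: at_within_Icc_at)
qed

text \<open>
  The orbit consists of the backward part \<open>x\<close> and the forward solution. At time \<open>0\<close> the one-sided
  derivatives of \<open>D z\<^sub>t\<close> agree, since both are \<open>F \<omega> x\<close>.
\<close>

lemma entire_orbit:
  fixes D :: "'m::finite bu \<Rightarrow> real ^ 'm" and F :: "'w::metric_space \<Rightarrow> 'm bu \<Rightarrow> real ^ 'm"
    and \<sigma> :: "real \<Rightarrow> 'w \<Rightarrow> 'w" and \<omega> :: 'w and x :: "'m bu"
  defines "z \<equiv> \<lambda>t. nfde_z D F \<sigma> t \<omega> x"
  assumes D1: "cond_D1 D" and D3: "cond_D3 D" and F: "cond_F1 \<Omega> F"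
    and flow: "continuous_flow \<Omega> \<sigma>" and \<Omega>: "compact \<Omega>" "\<omega> \<in> \<Omega>"
    and \<psi>: "backward_orbit_extension D F \<Omega> \<sigma> \<omega> x \<psi>"
    and time: "\<And>t. 0 \<le> t \<Longrightarrow> t \<in> nfde_time D F \<sigma> \<omega> x"
  shows "bu_path t z"
    and "s \<le> 0 \<Longrightarrow> snd (\<psi> s) = history z s"
    and "((\<lambda>t. D (history z t)) has_vector_derivative F (\<sigma> t \<omega>) (history z t)) (at t)"
proof -
  let ?z = z
  have sol: "nfde_solution D F \<sigma> \<omega> x T ?z" if "0 \<le> T" for T
    unfolding z_def by (rule nfde_solution_nfde_z[OF D1 D3 F flow \<Omega> time[OF that]])
  show "bu_path t ?z"
    by (rule nfde_solution_bu_path[OF sol[of "\<bar>t\<bar>"]]) auto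
  have hx: "history (apply_bu x) s = history ?z s" if "s \<le> 0" for s
    using that by (intro history_cong) (simp add: z_def nfde_z_def)
  note backward = backward_orbit_history[OF D1 D3 F flow \<Omega>(1) \<psi>]
  show "snd (\<psi> s) = history ?z s" if "s \<le> 0"
    using backward(1)[OF that] hx[OF that] by simp
  have left: "((\<lambda>t. D (history ?z t)) has_vector_derivative F (\<sigma> t \<omega>) (history ?z t)) (at t within {s..0})"
    if "s \<le> t" "t \<le> 0" for s t
  proof -
    have t: "t \<in> {s..0}" and s: "s \<le> 0" using that by auto
    show ?thesis
      using backward(2)[OF s t] unfolding hx[OF that(2)]
      by (rule has_vector_derivative_transform[OF t, rotated]) (simp add: hx)
  qed
  have right: "((\<lambda>t. D (history ?z t)) has_vector_derivative F (\<sigma> t \<omega>) (history ?z t)) (at t within {0..T})"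
    if "0 \<le> t" "t \<le> T" for t T
    using sol[of T] that by (simp add: nfde_solution_def)
  consider "t < 0" | "t = 0" | "0 < t" by linarith
  then show "((\<lambda>t. D (history ?z t)) has_vector_derivative F (\<sigma> t \<omega>) (history ?z t)) (at t)"
  proof cases
    case 1
    then show ?thesis
      using left[of "t - 1" t] at_within_Icc_at[of "t - 1" t 0] by simp
  next
    case 2
    then show ?thesis
      using has_vector_derivative_at_joint[OF left[of "-1" 0] right[of 0 1]] by simp
  next
    case 3
    then show ?thesis
      using right[of t "t + 1"] at_within_Icc_at[of 0 t "t + 1"] by simp
  qed
qed

section \<open>Difference quotients\<close>

text \<open>
  The difference quotients converge locally uniformly; the limit is a derivative of \<open>f\<close>, and it is
  continuous as a locally uniform limit of continuous functions.
\<close>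

lemma C1_differentiable_if_quotients_Cauchy:
  fixes f :: "real \<Rightarrow> 'a::banach"
  assumes f: "continuous_on UNIV f"
    and Cauchy: "\<And>N e. 0 < e \<Longrightarrow> \<exists>d>0. \<forall>h k t. h \<noteq> 0 \<longrightarrow> \<bar>h\<bar> < d \<longrightarrow> k \<noteq> 0 \<longrightarrow> \<bar>k\<bar> < d \<longrightarrow> \<bar>t\<bar> \<le> N \<longrightarrow>
      norm ((f (t + h) - f t) /\<^sub>R h - (f (t + k) - f t) /\<^sub>R k) \<le> e"
  shows "f C1_differentiable_on UNIV"
proof -
  let ?q = "\<lambda>h t. (f (t + h) - f t) /\<^sub>R h"
  define h where "h n = 1 / real (Suc n)" for n
  have h: "h n \<noteq> 0" "h n > 0" for n by (auto simp: h_def)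
  have "h \<longlonglongrightarrow> 0" unfolding h_def by (rule LIMSEQ_Suc[OF lim_1_over_n])
  then have small: "eventually (\<lambda>n. \<bar>h n\<bar> < d) sequentially" if "0 < d" for d
    using that tendstoD[of h 0 sequentially d] by (simp add: dist_real_def)
  have "convergent (\<lambda>n. ?q (h n) t)" for t
  proof (rule Cauchy_convergent, rule metric_CauchyI)
    fix e :: real assume "0 < e"
    then obtain d where "d > 0" and d: "\<And>a b. a \<noteq> 0 \<Longrightarrow> \<bar>a\<bar> < d \<Longrightarrow> b \<noteq> 0 \<Longrightarrow> \<bar>b\<bar> < d \<Longrightarrow> norm (?q a t - ?q b t) \<le> e / 2"
      using Cauchy[of "e / 2" "\<bar>t\<bar>"] by auto
    obtain M where "\<And>n. n \<ge> M \<Longrightarrow> \<bar>h n\<bar> < d"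
      using small[OF \<open>d > 0\<close>] by (auto simp: eventually_sequentially)
    then have "dist (?q (h m) t) (?q (h n) t) < e" if "m \<ge> M" "n \<ge> M" for m n
      using d[of "h m" "h n"] h that \<open>0 < e\<close> by (fastforce simp: dist_norm)
    then show "\<exists>M. \<forall>m\<ge>M. \<forall>n\<ge>M. dist (?q (h m) t) (?q (h n) t) < e" by blast
  qed
  then obtain p where p: "\<And>t. (\<lambda>n. ?q (h n) t) \<longlonglongrightarrow> p t"
    unfolding convergent_def by metis
  have unif: "\<exists>d>0. \<forall>k t. k \<noteq> 0 \<longrightarrow> \<bar>k\<bar> < d \<longrightarrow> \<bar>t\<bar> \<le> N \<longrightarrow> norm (?q k t - p t) \<le> e" if e: "0 < e" for N e
  proof -
    obtain d where "d > 0" and d: "\<And>a b t. a \<noteq> 0 \<Longrightarrow> \<bar>a\<bar> < d \<Longrightarrow> b \<noteq> 0 \<Longrightarrow> \<bar>b\<bar> < d \<Longrightarrow> \<bar>t\<bar> \<le> N \<Longrightarrow>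
        norm (?q a t - ?q b t) \<le> e"
      using Cauchy[OF e, of N] by blast
    have "norm (?q k t - p t) \<le> e" if k: "k \<noteq> 0" "\<bar>k\<bar> < d" "\<bar>t\<bar> \<le> N" for k t
    proof (rule Lim_norm_ubound[OF sequentially_bot])
      show "(\<lambda>n. ?q k t - ?q (h n) t) \<longlonglongrightarrow> ?q k t - p t"
        by (intro tendsto_intros p)
      show "eventually (\<lambda>n. norm (?q k t - ?q (h n) t) \<le> e) sequentially"
        using small[OF \<open>d > 0\<close>] by eventually_elim (use d k h in blast)
    qed
    then show ?thesis using \<open>d > 0\<close> by blast
  qed
  have "(f has_vector_derivative p t) (at t)" for t
    unfolding has_vector_derivative_def has_derivative_at_alt
  proof (intro conjI allI impI)
    fix e :: real assume "0 < e"
    then obtain d where d: "d > 0" "\<And>k. k \<noteq> 0 \<Longrightarrow> \<bar>k\<bar> < d \<Longrightarrow> norm (?q k t - p t) \<le> e"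
      using unif[of e "\<bar>t\<bar>"] by auto
    have "norm (f s - f t - (s - t) *\<^sub>R p t) \<le> e * norm (s - t)" if "norm (s - t) < d" for s
    proof (cases "s = t")
      case False
      then have "f s - f t - (s - t) *\<^sub>R p t = (s - t) *\<^sub>R (?q (s - t) t - p t)"
        by (simp add: scaleR_diff_right)
      then show ?thesis
        using d(2)[of "s - t"] that False by (simp add: mult.commute mult_left_mono)
    qed simp
    then show "\<exists>d>0. \<forall>s. norm (s - t) < d \<longrightarrow> norm (f s - f t - (s - t) *\<^sub>R p t) \<le> e * norm (s - t)"
      using d(1) by blast
  qed (rule bounded_linear_scaleR_left)
  moreover have "continuous_on UNIV p"
  proof -
    have "continuous_on (\<Union>N. {- N<..<N}) p"
    proof (rule continuous_on_open_UN)
      fix N :: real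
      show "continuous_on {- N<..<N} p"
      proof (rule uniform_limit_theorem)
        have "continuous_on {- N<..<N} (?q (h n))" for n
          by (intro continuous_intros continuous_on_compose2[OF f]) auto
        then show "eventually (\<lambda>n. continuous_on {- N<..<N} (?q (h n))) sequentially" by simp
        show "uniform_limit {- N<..<N} (\<lambda>n. ?q (h n)) p sequentially"
        proof (rule uniform_limitI)
          fix e :: real assume "0 < e"
          then obtain d where "d > 0" and d: "\<And>k t. k \<noteq> 0 \<Longrightarrow> \<bar>k\<bar> < d \<Longrightarrow> \<bar>t\<bar> \<le> N \<Longrightarrow> norm (?q k t - p t) \<le> e / 2"
            using unif[of "e / 2" N] by auto
          show "eventually (\<lambda>n. \<forall>t\<in>{- N<..<N}. dist (?q (h n) t) (p t) < e) sequentially"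
            using small[OF \<open>d > 0\<close>]
          proof eventually_elim
            case (elim n)
            show ?case
            proof
              fix t assume "t \<in> {- N<..<N}"
              then have "norm (?q (h n) t - p t) \<le> e / 2"
                using elim h by (intro d) auto
              then show "dist (?q (h n) t) (p t) < e" using \<open>0 < e\<close> by (simp add: dist_norm)
            qed
          qed
        qed
      qed simp
    qed simp
    moreover have "(\<Union>N. {- N<..<N}) = (UNIV :: real set)"
    proof (rule UNIV_eq_I[symmetric])
      fix t :: real
      have "t \<in> {- (\<bar>t\<bar> + 1)<..<\<bar>t\<bar> + 1}" by auto
      then show "t \<in> (\<Union>N. {- N<..<N})" by blast
    qed
    ultimately show ?thesis by simp
  qed
  ultimately show ?thesis
    unfolding C1_differentiable_on_def by blast
qed

text \<open>
  The difference quotients \<open>V h t\<close> of the orbit \<open>t \<mapsto> z\<^sub>t\<close> lie in the phase space, and \<open>D\<close> maps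
  them to the difference quotients of \<open>t \<mapsto> D z\<^sub>t\<close>. These are bounded by \<open>G\<close>, so the global estimate bounds
  \<open>V h t - V k t\<close> uniformly in \<open>h\<close>, \<open>k\<close> and \<open>t\<close>. They also converge to \<open>g\<close> locally uniformly,
  so by the local estimate the values of \<open>V h t\<close> at \<open>0\<close>, which are the difference quotients of \<open>z\<close>, are
  locally uniformly Cauchy.
\<close>

lemma stable_C1_inverse:
  assumes D1: "cond_D1 D" and D3: "cond_D3 D" and D4: "cond_D4 D"
    and z: "\<And>t. bu_path t z"
    and deriv: "\<And>t. ((\<lambda>t. D (history z t)) has_vector_derivative g t) (at t)"
    and g: "continuous_on UNIV g" "\<And>t. norm (g t) \<le> G"
  shows "z C1_differentiable_on UNIV"
proof (rule C1_differentiable_if_quotients_Cauchy)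
  show "continuous_on UNIV z"
    by (intro continuous_on_UNIV_if_atMost bu_path_imp_continuous z)
  fix N e :: real assume e: "0 < e"
  have lin: "linear D" using D1 by (simp add: cond_D1_def)
  define y where "y t = D (history z t)" for t
  have y: "(y has_vector_derivative g t) (at t within S)" for t S
    using deriv[of t] unfolding y_def by (rule has_vector_derivative_at_within)
  define V where "V h t = (history z (t + h) - history z t) /\<^sub>R h" for h t
  have V: "apply_bu (V h t) s = (z (t + h + min s 0) - z (t + min s 0)) /\<^sub>R h" for h t s
    by (simp add: V_def scaleR_bu.rep_eq minus_bu.rep_eq apply_history_path z)
  have hV: "history (apply_bu (V h t - V k t)) r = V h (t + r) - V k (t + r)" if "r \<le> 0" for h k t r
    using that by (intro bu_eqI, subst apply_history_path[OF bu_path_apply_bu])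
      (simp add: minus_bu.rep_eq V add_ac)
  have DV: "D (V h t) = (y (t + h) - y t) /\<^sub>R h" for h t
    by (simp add: V_def y_def linear_scale[OF lin] linear_diff[OF lin])
  have G: "0 \<le> G" using order_trans[OF norm_ge_zero g(2)] .
  have DV_bound: "norm (D (V h t)) \<le> G" for h t
  proof -
    have "norm (y (t + h) - y t) \<le> G * norm (t + h - t)"
    proof (rule differentiable_bound[OF convex_UNIV])
      show "(y has_derivative (\<lambda>h. h *\<^sub>R g s)) (at s within UNIV)" for s
        using y unfolding has_vector_derivative_def .
      show "onorm (\<lambda>h. h *\<^sub>R g s) \<le> G" for s
        using G g(2)[of s] by (intro onorm_bound) (auto simp: mult.commute[of G] mult_left_mono)
    qed auto
    then show ?thesis
      using G by (simp add: DV divide_simps mult.commute)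
  qed
  obtain C where C: "\<And>v b. (\<And>r. r \<le> 0 \<Longrightarrow> norm (D (history (apply_bu v) r)) \<le> b) \<Longrightarrow> norm v \<le> C * b"
    using stable_global_estimate[OF D1 D3 D4] by blast
  have V_bound: "norm (V h t - V k t) \<le> C * (2 * G)" for h k t
  proof (rule C)
    fix r :: real assume r: "r \<le> 0"
    show "norm (D (history (apply_bu (V h t - V k t)) r)) \<le> 2 * G"
      using norm_triangle_ineq4[of "D (V h (t + r))" "D (V k (t + r))"]
        DV_bound[of h "t + r"] DV_bound[of k "t + r"]
      by (simp add: hV[OF r] linear_diff[OF lin])
  qed
  define R where "R = C * (2 * G)"
  have R: "0 \<le> R" using order_trans[OF norm_ge_zero V_bound] unfolding R_def .
  \<comment> \<open>\<open>\<mu>\<close> compares the Euclidean with the maximum norm; \<open>\<eta>\<close> and \<open>b\<close> are chosen so that either summand of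
    the local estimate contributes \<open>e / (2 * \<mu>)\<close>, and the summands \<open>1\<close> avoid division by zero.\<close>
  define \<mu> where "\<mu> = sqrt (real DIM(real ^ 'a))"
  have \<mu>: "0 < \<mu>" by (simp add: \<mu>_def)
  define \<eta> where "\<eta> = e / (2 * \<mu> * (R + 1))"
  have \<eta>: "0 < \<eta>" using e \<mu> R by (simp add: \<eta>_def)
  obtain \<tau> K where K: "0 \<le> \<tau>" "0 \<le> K"
    "\<And>v b. (\<And>r. - \<tau> \<le> r \<Longrightarrow> r \<le> 0 \<Longrightarrow> norm (D (history (apply_bu v) r)) \<le> b) \<Longrightarrow>
      infnorm (apply_bu v 0) \<le> \<eta> * norm v + K * b"
    using stable_local_estimate[OF D1 D3 D4 \<eta>] by blast
  define b where "b = e / (4 * \<mu> * (K + 1))"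
  have b: "0 < b" using e \<mu> K by (simp add: b_def)
  \<comment> \<open>The estimate at time \<open>t\<close> looks back by \<open>\<tau>\<close>, and the quotients look ahead or back by less than \<open>1\<close>.\<close>
  have "uniformly_continuous_on {- (\<bar>N\<bar> + \<tau> + 1)..\<bar>N\<bar> + \<tau> + 1} g"
    by (intro compact_uniformly_continuous compact_Icc continuous_on_subset[OF g(1)]) simp
  then obtain d where d: "d > 0" "\<And>s t. \<bar>s\<bar> \<le> \<bar>N\<bar> + \<tau> + 1 \<Longrightarrow> \<bar>t\<bar> \<le> \<bar>N\<bar> + \<tau> + 1 \<Longrightarrow> \<bar>s - t\<bar> < d \<Longrightarrow>
      norm (g s - g t) < b"
    unfolding uniformly_continuous_on_def dist_norm using b by (metis abs_le_iff atLeastAtMost_iff minus_le_iff real_norm_def)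
  have DV_near: "norm (D (V h t) - g t) \<le> b" if h: "h \<noteq> 0" "\<bar>h\<bar> < min d 1" and t: "\<bar>t\<bar> \<le> \<bar>N\<bar> + \<tau>" for h t
  proof -
    have "norm (y (t + h) - y t - (t + h - t) *\<^sub>R g t) \<le> norm (t + h - t) * b"
    proof (rule vector_differentiable_bound_linearization[OF y order_refl])
      fix s assume "s \<in> closed_segment t (t + h)"
      then have "\<bar>s - t\<bar> \<le> \<bar>h\<bar>" by (auto simp: closed_segment_eq_real_ivl split: if_splits)
      then show "norm (g s - g t) \<le> b"
        using h t by (intro less_imp_le d(2)) auto
    qed simp
    moreover have "D (V h t) - g t = (y (t + h) - y t - (t + h - t) *\<^sub>R g t) /\<^sub>R h"
      using h by (simp add: DV scaleR_diff_right)
    ultimately show ?thesis using h by (simp add: divide_simps mult.commute)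
  qed
  show "\<exists>d>0. \<forall>h k t. h \<noteq> 0 \<longrightarrow> \<bar>h\<bar> < d \<longrightarrow> k \<noteq> 0 \<longrightarrow> \<bar>k\<bar> < d \<longrightarrow> \<bar>t\<bar> \<le> N \<longrightarrow>
      norm ((z (t + h) - z t) /\<^sub>R h - (z (t + k) - z t) /\<^sub>R k) \<le> e"
  proof (intro exI[of _ "min d 1"] conjI allI impI)
    fix h k t assume h: "h \<noteq> 0" "\<bar>h\<bar> < min d 1" and k: "k \<noteq> 0" "\<bar>k\<bar> < min d 1" and t: "\<bar>t\<bar> \<le> N"
    let ?v = "V h t - V k t"
    have "infnorm (apply_bu ?v 0) \<le> \<eta> * norm ?v + K * (2 * b)"
    proof (rule K(3))
      fix r assume r: "- \<tau> \<le> r" "r \<le> 0"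
      then have "\<bar>t + r\<bar> \<le> \<bar>N\<bar> + \<tau>" using t by auto
      then show "norm (D (history (apply_bu ?v) r)) \<le> 2 * b"
        using norm_triangle_ineq4[of "D (V h (t + r)) - g (t + r)" "D (V k (t + r)) - g (t + r)"]
          DV_near[OF h, of "t + r"] DV_near[OF k, of "t + r"]
        by (simp add: hV[OF r(2)] linear_diff[OF lin])
    qed
    also have "\<dots> \<le> \<eta> * (R + 1) + (K + 1) * (2 * b)"
      using V_bound[of h t k] \<eta> b unfolding R_def by (intro add_mono mult_left_mono mult_right_mono) auto
    also have "\<eta> * (R + 1) = e / (2 * \<mu>)"
      using R by (simp add: \<eta>_def)
    also have "(K + 1) * (2 * b) = e / (2 * \<mu>)"
      using K(2) by (simp add: b_def)
    finally have "\<mu> * infnorm (apply_bu ?v 0) \<le> e"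
      using \<mu> by (simp add: field_simps)
    then have "norm (apply_bu ?v 0) \<le> e"
      using norm_le_infnorm[of "apply_bu ?v 0"] unfolding \<mu>_def by linarith
    then show "norm ((z (t + h) - z t) /\<^sub>R h - (z (t + k) - z t) /\<^sub>R k) \<le> e"
      by (simp add: minus_bu.rep_eq V)
  qed (use d in simp)
qed

theorem proposition3p2:
  fixes D :: "'m::finite bu \<Rightarrow> real ^ 'm"
    and \<Omega> :: "'w::metric_space set" and \<sigma> :: "real \<Rightarrow> 'w \<Rightarrow> 'w"
    and F :: "'w \<Rightarrow> 'm bu \<Rightarrow> real ^ 'm"
    and \<omega> :: 'w and x :: "'m bu" and \<psi> :: "real \<Rightarrow> 'w \<times> 'm bu" and k\<^sub>1 :: real
  assumes "cond_D1 D" "cond_D2 D" "cond_D3 D" "cond_D4 D"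
    and "minimal_flow \<Omega> \<sigma>"
    and "cond_F1 \<Omega> F" "cond_F2 \<Omega> F" "cond_F3 \<Omega> F"
    and "\<omega> \<in> \<Omega>"
    and "backward_orbit_extension D F \<Omega> \<sigma> \<omega> x \<psi>"
    and "k\<^sub>1 > 0"
    and "\<forall>t\<le>0. snd (\<psi> t) \<in> B\<^bsub>k\<^sub>1\<^esub>"
    and "\<forall>t\<ge>0. t \<in> nfde_time D F \<sigma> \<omega> x \<and> nfde_u D F \<sigma> t \<omega> x \<in> B\<^bsub>k\<^sub>1\<^esub>"
  shows "(\<lambda>t. nfde_z D F \<sigma> t \<omega> x) C1_differentiable_on UNIV"
proof -
  have flow: "continuous_flow \<Omega> \<sigma>" and \<Omega>: "compact \<Omega>"
    using assms(5) by (auto simp: minimal_flow_def)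
  let ?z = "\<lambda>t. nfde_z D F \<sigma> t \<omega> x"
  let ?g = "\<lambda>t. F (\<sigma> t \<omega>) (history ?z t)"
  note orbit = entire_orbit[OF assms(1,3,6) flow \<Omega> assms(9,10)]
  have time: "t \<in> nfde_time D F \<sigma> \<omega> x" if "0 \<le> t" for t using assms(13) that by blast
  have ball: "norm (history ?z t) \<le> k\<^sub>1" for t
  proof (cases "t \<le> 0")
    case True
    then show ?thesis using assms(12) orbit(2)[OF time True] by auto
  next
    case False
    then show ?thesis using assms(13) by (simp add: nfde_u_def)
  qed
  have \<sigma>: "\<sigma> t \<omega> \<in> \<Omega>" for t using flow assms(9) by (simp add: continuous_flow_def)
  have "continuous_on UNIV (\<lambda>t. case (t, \<omega>) of (t, \<omega>) \<Rightarrow> \<sigma> t \<omega>)"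
  proof (rule continuous_on_compose2[where g = "\<lambda>(t, \<omega>). \<sigma> t \<omega>"])
    show "continuous_on (UNIV \<times> \<Omega>) (\<lambda>(t, \<omega>). \<sigma> t \<omega>)" using flow by (simp add: continuous_flow_def)
  qed (use assms(9) in \<open>auto intro!: continuous_intros\<close>)
  then have pair: "continuous_on UNIV (\<lambda>t. (\<sigma> t \<omega>, history ?z t))"
    by (intro continuous_on_Pair continuous_on_UNIV_history orbit(1) time) simp_all
  have "continuous_on UNIV (\<lambda>t. case (\<sigma> t \<omega>, history ?z t) of (\<omega>, x) \<Rightarrow> F \<omega> x)"
    by (rule continuous_on_compose2[where g = "\<lambda>(\<omega>, x). F \<omega> x", OF _ pair, of "\<Omega> \<times> UNIV"])
      (use assms(6) \<sigma> in \<open>auto simp: cond_F1_def\<close>)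
  then have cont: "continuous_on UNIV ?g" by simp
  have "bounded ((\<lambda>(\<omega>, x). F \<omega> x) ` (\<Omega> \<times> B\<^bsub>k\<^sub>1\<^esub>))"
    using assms(7,11) by (simp add: cond_F2_def)
  then obtain G where "\<forall>p\<in>\<Omega> \<times> B\<^bsub>k\<^sub>1\<^esub>. norm (case p of (\<omega>, x) \<Rightarrow> F \<omega> x) \<le> G"
    by (auto simp: bounded_iff)
  then have G: "norm (F \<omega> x) \<le> G" if "\<omega> \<in> \<Omega>" "norm x \<le> k\<^sub>1" for \<omega> x
    using that by auto
  show ?thesis
    by (rule stable_C1_inverse[OF assms(1,3,4) orbit(1)[OF time] orbit(3)[OF time] cont G[OF \<sigma> ball]])
qed

end
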